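(* Let $n\ge 3$ be an integer, $r>0$, and let $F$ be the chord length distribution function of $\mathcal P_{n,r}$. Then $F(s)=0$ for $s\le 0$, $F(s)=1$ for $s\ge \ell_{K+1}$, and for every $k\in\{0,\dots,K\}$ and every $s$ with $\ell_k\le s<\ell_{k+1}$ and $s>0$ we have $F(s)=H_k(s)$, where $H_k(s)$ is given as follows. (i) If $n$ is even and $k\in\{0,\dots,K-1\}$, or if $n$ is odd and $s<\lambda$: $$H_k(s)=1-h_k\big(s,A_1(k),B_1(k)\big)+h_{k+1}\big(s,A_1(k),B_1(k)+\tfrac{\pi}{n}\big).$$ (ii) If $n$ is odd and $s\ge\lambda$ (which forces $k=K$): $$H_K(s)=1-h_K\big(s,A_1(K),B_1(K)\big)+h_{K+1}\big(s,A_1(K),B_1(K)+\tfrac{\pi}{n}\big)-h_{K+1}\big(s,A_2,B_2+\tfrac{\pi}{n}\big)-h_{K+1}\big(s,A_2,B_2\big).$$ (iii) If $n$ is even and $k=K$: $$H_K(s)=1-h_K\big(s,A_1(K),B_1(K)\big).$$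
   Context: Let $n\ge 3$ be an integer and $r>0$. $\mathcal P_{n,r}$ denotes the regular polygon with $n$ sides whose circumscribed circle has radius $r$ and centre at the origin $O$. Its perimeter is $u=2nr\sin(\pi/n)$. A line in the plane is written $g(p,\phi)=\{(x,y)\in\mathbb R^2: x\cos\phi+y\sin\phi=p\}$ with $p\ge 0$, $0\le\phi<2\pi$; the measure $\mu$ of a set of lines is the integral of $dp\,d\phi$ over the set (the motion-invariant line measure). For a line $g$ meeting $\mathcal P_{n,r}$, $\chi(g)=g\cap\mathcal P_{n,r}$ is its chord and $|\chi(g)|$ its length. The chord length distribution function is $F(s)=\frac1u\,\mu(\{g: g\cap\mathcal P_{n,r}\neq\emptyset,\ |\chi(g)|\le s\})$ (the measure of all lines meeting $\mathcal P_{n,r}$ equals $u$). Notation: $K=\lfloor (n-2)/2\rfloor$; $\ell_k=2r\sin(k\pi/n)$ for $k=0,\dots,K+1$; $\lambda=2r\cos^2\frac{\pi}{2n}$; $A_1(k)=2r\sin\frac{k\pi}{n}\sin\frac{(k+1)\pi}{n}$, $B_1(k)=\frac{k\pi}{n}$; $A_2=2r\cos^2\frac{\pi}{2n}$, $B_2=\frac{\pi}{2}\big(1-\frac1n\big)$. For integers $k\ge1$ (only values with $\sin(2k\pi/n)\ne0$ and $\cos(k\pi/n)\neq 0$ occur) and reals $a,b$: $\Theta_1(k,a,b)=\frac{1}{4r}\csc\frac{\pi}{n}\big(\sin(2b)\csc\frac{2k\pi}{n}-2b\cot\frac{2k\pi}{n}\big)$, $\Theta_2(k,a,b)=a\big(\cos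 b\cot\frac{\pi}{n}\sec\frac{k\pi}{n}-\frac{a}{2r}\sin(2b)\csc\frac{\pi}{n}\csc\frac{2k\pi}{n}\big)$, $\Theta_3(k,a,b)=-\big(\sin b\cot\frac{\pi}{n}\sec\frac{k\pi}{n}+\frac{a}{2r}\cos(2b)\csc\frac{\pi}{n}\csc\frac{2k\pi}{n}\big)$, $\Theta_4(k,a,b)=\frac{1}{2r}\csc\frac{\pi}{n}\cot\frac{2k\pi}{n}$. For $s>0$ with $s\ge a\ge0$: $L_1(s,a)=s$, $L_2(s,a)=1/s$, $L_3(s,a)=\sqrt{s^2-a^2}/s$, $L_4(s,a)=s\arcsin(a/s)$, and $h_k(s,a,b)=0$ if $k=0$, $h_k(s,a,b)=\sum_{i=1}^4\Theta_i(k,a,b)L_i(s,a)$ if $k\ge1$. *)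

theory Defs
  imports "HOL-Analysis.Analysis"
begin

definition poly_vertex :: "nat \<Rightarrow> real \<Rightarrow> nat \<Rightarrow> real \<times> real" where
  "poly_vertex n r j = (r * cos (2 * pi * real j / real n), r * sin (2 * pi * real j / real n))"

definition reg_polygon :: "nat \<Rightarrow> real \<Rightarrow> (real \<times> real) set" where
  "reg_polygon n r = convex hull (poly_vertex n r ` {..<n})"

definition line_pphi :: "real \<Rightarrow> real \<Rightarrow> (real \<times> real) set" where
  "line_pphi p \<phi> = {(x, y). x * cos \<phi> + y * sin \<phi> = p}"

definition perimeter :: "nat \<Rightarrow> real \<Rightarrow> real" where
  "perimeter n r = 2 * real n * r * sin (pi / real n)"

text \<open>Chord length distribution function; the measure on lines is Lebesgue measure dp dphi
  on the parameter set p \<ge> 0, 0 \<le> phi < 2 pi. The chord length is the diameter of the chord.\<close>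
definition chord_F :: "nat \<Rightarrow> real \<Rightarrow> real \<Rightarrow> real" where
  "chord_F n r s = measure lborel
     {(p, \<phi>). 0 \<le> p \<and> 0 \<le> \<phi> \<and> \<phi> < 2 * pi \<and>
        line_pphi p \<phi> \<inter> reg_polygon n r \<noteq> {} \<and>
        diameter (line_pphi p \<phi> \<inter> reg_polygon n r) \<le> s} / perimeter n r"

definition Kn :: "nat \<Rightarrow> nat" where "Kn n = (n - 2) div 2"

definition ell :: "nat \<Rightarrow> real \<Rightarrow> nat \<Rightarrow> real" where
  "ell n r k = 2 * r * sin (real k * pi / real n)"

definition lam :: "nat \<Rightarrow> real \<Rightarrow> real" where
  "lam n r = 2 * r * (cos (pi / (2 * real n)))\<^sup>2"

definition A1 :: "nat \<Rightarrow> real \<Rightarrow> nat \<Rightarrow> real" where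
  "A1 n r k = 2 * r * sin (real k * pi / real n) * sin (real (k + 1) * pi / real n)"

definition B1 :: "nat \<Rightarrow> nat \<Rightarrow> real" where
  "B1 n k = real k * pi / real n"

definition A2 :: "nat \<Rightarrow> real \<Rightarrow> real" where
  "A2 n r = 2 * r * (cos (pi / (2 * real n)))\<^sup>2"

definition B2 :: "nat \<Rightarrow> real" where
  "B2 n = pi / 2 * (1 - 1 / real n)"

definition csc :: "real \<Rightarrow> real" where "csc x = 1 / sin x"
definition sec :: "real \<Rightarrow> real" where "sec x = 1 / cos x"

definition Theta1 :: "nat \<Rightarrow> real \<Rightarrow> nat \<Rightarrow> real \<Rightarrow> real \<Rightarrow> real" where
  "Theta1 n r k a b = 1 / (4 * r) * csc (pi / real n) *
     (sin (2 * b) * csc (2 * real k * pi / real n) - 2 * b * cot (2 * real k * pi / real n))"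

definition Theta2 :: "nat \<Rightarrow> real \<Rightarrow> nat \<Rightarrow> real \<Rightarrow> real \<Rightarrow> real" where
  "Theta2 n r k a b = a * (cos b * cot (pi / real n) * sec (real k * pi / real n)
     - a / (2 * r) * sin (2 * b) * csc (pi / real n) * csc (2 * real k * pi / real n))"

definition Theta3 :: "nat \<Rightarrow> real \<Rightarrow> nat \<Rightarrow> real \<Rightarrow> real \<Rightarrow> real" where
  "Theta3 n r k a b = - (sin b * cot (pi / real n) * sec (real k * pi / real n)
     + a / (2 * r) * cos (2 * b) * csc (pi / real n) * csc (2 * real k * pi / real n))"

definition Theta4 :: "nat \<Rightarrow> real \<Rightarrow> nat \<Rightarrow> real \<Rightarrow> real \<Rightarrow> real" where
  "Theta4 n r k a b = 1 / (2 * r) * csc (pi / real n) * cot (2 * real k * pi / real n)"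

definition hk :: "nat \<Rightarrow> real \<Rightarrow> nat \<Rightarrow> real \<Rightarrow> real \<Rightarrow> real \<Rightarrow> real" where
  "hk n r k s a b = (if k = 0 then 0 else
      Theta1 n r k a b * s
    + Theta2 n r k a b * (1 / s)
    + Theta3 n r k a b * (sqrt (s\<^sup>2 - a\<^sup>2) / s)
    + Theta4 n r k a b * (s * arcsin (a / s)))"

end

theory Submission
  imports Defs
begin

text \<open>For a fixed normal direction \<open>\<phi>\<close> the offsets \<open>p\<close> of the lines whose chord is longer than \<open>s\<close>
  form an interval, because the chord length is concave in \<open>p\<close>. As \<open>(p, \<phi>)\<close> and \<open>(- p, \<phi> + \<pi>)\<close> are
  the same line, and by the symmetries of the polygon, the measure of these lines is \<open>2 n\<close> times the
  integral of the upper end of this interval over one angular cell of width \<open>\<pi> / n\<close>. At its upper end the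
  line crosses two sides with some offset \<open>k\<close>, where the chord length is affine in \<open>p\<close>; solving for
  \<open>p\<close> gives \<open>d cos \<psi> / cos \<kappa> - s (cos\<^sup>2 \<psi> - cos\<^sup>2 \<kappa>) / sin (2 \<kappa>)\<close> with \<open>d = r cos (\<pi> / n)\<close>, \<open>\<kappa> = k \<pi> / n\<close>.
  The function \<open>h\<^sub>k(s, a, b)\<close> is, up to the factor \<open>- 1 / (r sin (\<pi> / n))\<close>, the primitive of this
  expression at \<open>b - arcsin (a / s)\<close>, and the directions at which \<open>k\<close> changes (or the interval becomes
  empty) are those where the chord through a vertex has length exactly \<open>s\<close>; there \<open>a\<close> is the
  distance of that vertex from the opposite side.\<close>

subsection \<open>Line sets with dihedral symmetry\<close>

text \<open>For \<open>k \<ge> 1\<close> the chord through the vertex where offset \<open>k\<close>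
  gives way to \<open>k + 1\<close> has length \<open>A1 n r k / sin (\<kappa> + \<psi>)\<close>,
  \<psi> being the position of the direction in its cell. Across the cell it falls from
  \<open>ell n r (k + 1)\<close> to \<open>ell n r k\<close>, which is why these lengths bound the
  pieces of the formula: for s between them the change of offset lies in that cell. The obstacle is
  that offset \<open>k + 1\<close> has its natural position in the next cell. Neighbouring cells are
  mirror images, so it is read there at \<open>\<pi> / n - \<psi>\<close>; this produces the shift
  \<pi> / n of the third argument and the opposite signs of the two terms. Offset
  \<open>k + 1\<close> can in turn end in the same cell only if it is the largest one. For even n
  its sides are parallel and it contributes nothing. For odd n a vertex faces a side, the vertex
  chord is shortest in the middle of the cell, where its length is the height \<open>lam n r\<close>
  of the polygon, and larger s cut out a symmetric gap whose two ends give the terms with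
  \<open>A2\<close>.\<close>

lemma has_integral_reflect_about:
  fixes f :: "real \<Rightarrow> real"
  assumes "(f has_integral I) {a..b}"
  shows "((\<lambda>x. f (c - x)) has_integral I) {c - b..c - a}"
proof -
  have "((\<lambda>x. f ((-1) *\<^sub>R x + c)) has_integral (1 / \<bar>-1\<bar> ^ DIM(real)) *\<^sub>R I)
      ((\<lambda>x. (1 / (-1)) *\<^sub>R x + -((1 / (-1)) *\<^sub>R c)) ` cbox a b)"
    using assms by (intro has_integral_affinity) auto
  moreover have "(\<lambda>x. (1 / (-1)) *\<^sub>R x + -((1 / (-1)) *\<^sub>R c)) ` cbox a b = {c - b..c - a}"
    by (auto simp: image_iff intro!: bexI[of _ "c - _"])
  ultimately show ?thesis by (simp add: algebra_simps)
qed

lemma has_integral_translate: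
  fixes f :: "real \<Rightarrow> real"
  assumes "(f has_integral I) {a..b}"
  shows "((\<lambda>x. f (x + c)) has_integral I) {a - c..b - c}"
  using has_integral_reflect_about[OF has_integral_reflect_about[OF assms, of 0], of "- c"]
  by (simp add: algebra_simps)

section \<open>Even periodic functions on consecutive cells\<close>

context
  fixes f :: "real \<Rightarrow> real" and a I :: real
  assumes per: "\<And>x. f (x + 2 * a) = f x" and even: "\<And>x. f (- x) = f x" and a: "0 \<le> a"
begin

lemma periodic_nat: "f (x + 2 * real j * a) = f x"
proof (induction j)
  case (Suc j)
  have "f (x + 2 * real (Suc j) * a) = f ((x + 2 * real j * a) + 2 * a)" by (simp add: algebra_simps)
  then show ?case using Suc per by simp
qed simp

lemma reflect_cell: "f (2 * real j * a - x) = f x"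
  using periodic_nat[of "-x" j] even[of x] by (simp add: algebra_simps)

text \<open>Reflection about the common end \<open>real (Suc j) * a\<close> exchanges the two cells
  and preserves \<open>f\<close>. Periodicity alone would link only every second cell.\<close>

lemma has_integral_cell_Suc:
  "(f has_integral I) {real j * a..real (Suc j) * a} \<longleftrightarrow>
   (f has_integral I) {real (Suc j) * a..real (Suc (Suc j)) * a}" (is "?L = ?R")
proof
  let ?c = "2 * real (Suc j) * a"
  have fe: "(\<lambda>x. f (?c - x)) = f" using reflect_cell[of "Suc j"] by auto
  show ?R if ?L using has_integral_reflect_about[OF that, of ?c] fe by (simp add: algebra_simps)
  show ?L if ?R using has_integral_reflect_about[OF that, of ?c] fe by (simp add: algebra_simps)
qed

lemma has_integral_cell:
  assumes "(f has_integral I) {real j * a..real (Suc j) * a}"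
  shows "(f has_integral I) {real i * a..real (Suc i) * a}"
proof -
  have "(f has_integral I) {real j * a..real (Suc j) * a} \<longleftrightarrow> (f has_integral I) {0..a}" for j
  proof (induction j)
    case (Suc j) then show ?case using has_integral_cell_Suc[of j] by simp
  qed simp
  then show ?thesis using assms by blast
qed

lemma has_integral_cells:
  assumes "(f has_integral I) {real j * a..real (Suc j) * a}"
  shows "(f has_integral (real m * I)) {real i * a..real (i + m) * a}"
proof (induction m)
  case (Suc m)
  have "(f has_integral (real m * I + I)) {real i * a..real (i + Suc m) * a}"
    using Suc has_integral_cell[OF assms, of "i + m"] a
    by (intro has_integral_combine[of _ "real (i + m) * a"]) (auto intro!: mult_right_mono)
  then show ?case by (simp add: algebra_simps)
qed (simp add: has_integral_refl)

end

lemma emeasure_lborel_interval_between: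
  fixes S :: "real set"
  assumes "{a<..<b} \<subseteq> S" "S \<subseteq> {a..b}" "S \<in> sets borel" "a \<le> b"
  shows "emeasure lborel S = ennreal (b - a)"
proof (rule antisym)
  show "emeasure lborel S \<le> ennreal (b - a)"
    using emeasure_mono[OF assms(2), of lborel] assms by simp
  show "ennreal (b - a) \<le> emeasure lborel S"
    using emeasure_mono[OF assms(1), of lborel] assms by simp
qed

text \<open>The ends may or may not belong to \<open>S\<close>, so the measure is squeezed between
  those of an open and a closed interval. Truncating both ends at 0 covers every position relative
  to the origin.\<close>

lemma emeasure_interval_nonneg_part:
  fixes S :: "real set"
  assumes S: "is_interval S" "S \<noteq> {}" "S \<subseteq> {-R..R}" "S \<in> sets borel"
  shows "emeasure lborel {p \<in> S. 0 \<le> p} = ennreal (max 0 (Sup S) - max 0 (Inf S))"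
proof -
  have bdd: "bdd_above S" "bdd_below S"
    using S(3) by (auto intro!: bdd_aboveI[of _ R] bdd_belowI[of _ "-R"])
  have up: "x \<le> Sup S" "Inf S \<le> x" if "x \<in> S" for x
    using that bdd by (auto intro: cSup_upper cInf_lower)
  have le: "Inf S \<le> Sup S" using S(2) up by fastforce
  have ins: "x \<in> S" if "Inf S < x" "x < Sup S" for x
  proof -
    obtain y z where "y \<in> S" "y < x" "z \<in> S" "x < z"
      using \<open>Inf S < x\<close> \<open>x < Sup S\<close> S(2) bdd by (meson cInf_less_iff less_cSup_iff)
    then show ?thesis using S(1) mem_is_interval_1_I[of S y z x] by simp
  qed
  have meas: "{p \<in> S. 0 \<le> p} \<in> sets borel"
  proof -
    have "{p \<in> S. 0 \<le> p} = S \<inter> {0..}" by auto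
    then show ?thesis using S(4) by simp
  qed
  show ?thesis
  proof (cases "0 \<le> Sup S")
    case True
    have "emeasure lborel {p \<in> S. 0 \<le> p} = ennreal (Sup S - max 0 (Inf S))"
      using True le up ins by (intro emeasure_lborel_interval_between meas) auto
    then show ?thesis using True by (simp add: max_def)
  next
    case False
    then have "{p \<in> S. 0 \<le> p} = {}" using up(1) by fastforce
    then show ?thesis using False le by (simp only: emeasure_empty) (simp add: max_def)
  qed
qed

text \<open>The parameters \<open>(p, \<phi>)\<close> and \<open>(- p, \<phi> + \<pi>)\<close> describe the same line, so the lower end of a
  slice is minus the upper end of the opposite one; integrating over all directions, only upper
  ends remain, and these are the same function on each of the \<open>2 n\<close> angular cells, up to reflection.\<close>
lemma emeasure_symmetric_line_set:
  fixes X :: "real \<Rightarrow> real set" and n :: nat and R I :: real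
  assumes n: "0 < n"
    and meas: "{(p, \<phi>). p \<in> X \<phi>} \<in> sets borel"
    and ivl: "\<And>\<phi>. is_interval (X \<phi>)"
    and bd: "\<And>\<phi>. X \<phi> \<subseteq> {-R..R}"
    and rot: "\<And>\<phi>. X (\<phi> + 2 * (pi / n)) = X \<phi>"
    and refl: "\<And>\<phi>. X (- \<phi>) = X \<phi>"
    and opp: "\<And>\<phi>. X (\<phi> + pi) = uminus ` X \<phi>"
    and g: "(g has_integral I) {0..pi / n}"
    and fin: "finite N"
    and gX: "\<And>\<psi>. 0 < \<psi> \<Longrightarrow> \<psi> < pi / n \<Longrightarrow> \<psi> \<notin> N \<Longrightarrow>
               g \<psi> = (if X (real j * (pi / n) + \<psi>) = {} then 0 else Sup (X (real j * (pi / n) + \<psi>)))"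
  shows "{(p, \<phi>). 0 \<le> p \<and> 0 \<le> \<phi> \<and> \<phi> < 2 * pi \<and> p \<in> X \<phi>} \<in> sets lborel"
    and "emeasure lborel {(p, \<phi>). 0 \<le> p \<and> 0 \<le> \<phi> \<and> \<phi> < 2 * pi \<and> p \<in> X \<phi>} = ennreal (2 * real n * I)"
    and "0 \<le> 2 * real n * I"
proof -
  let ?a = "pi / real n"
  let ?A = "{(p, \<phi>). 0 \<le> p \<and> 0 \<le> \<phi> \<and> \<phi> < 2 * pi \<and> p \<in> X \<phi>}"
  have a: "0 \<le> ?a" by simp
  have "?A = {(p, \<phi>). p \<in> X \<phi>} \<inter> ({0..} \<times> {0..<2 * pi})" by auto
  moreover have "({0..} \<times> {0..<2 * pi} :: (real \<times> real) set) \<in> sets borel"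
    by (simp add: borel_Times)
  ultimately have A: "?A \<in> sets borel" using meas by simp
  then show "?A \<in> sets lborel" by simp
  \<comment> \<open>The default 0 fits the slice formula: the slice opposite to an empty one is
    empty too, so both truncated ends vanish.\<close>
  define Q where "Q \<phi> = (if X \<phi> = {} then 0 else Sup (X \<phi>))" for \<phi>
  have slice: "X \<phi> \<in> sets borel" for \<phi>
    using is_interval_convex ivl[of \<phi>] by (metis real_interval_borel_measurable is_interval_def)
  have Q_bound: "\<bar>Q \<phi>\<bar> \<le> max 0 R" for \<phi>
  proof (cases "X \<phi> = {}")
    case False
    then obtain x where x: "x \<in> X \<phi>" by auto
    have "x \<le> Sup (X \<phi>)" using x bd[of \<phi>] by (intro cSup_upper bdd_aboveI[of _ R]) auto
    moreover have "Sup (X \<phi>) \<le> R" using False bd[of \<phi>] by (intro cSup_least) auto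
    ultimately show ?thesis using False x bd[of \<phi>] by (auto simp: Q_def)
  qed (simp add: Q_def)
  have Q_per: "Q (\<phi> + 2 * ?a) = Q \<phi>" and Q_even: "Q (- \<phi>) = Q \<phi>" for \<phi>
    using rot[of \<phi>] refl[of \<phi>] by (simp_all add: Q_def)
  have QI: "(Q has_integral I) {real j * ?a..real (Suc j) * ?a}"
  proof -
    have "((\<lambda>\<phi>. g (\<phi> + - (real j * ?a))) has_integral I) {real j * ?a..real (Suc j) * ?a}"
      using has_integral_translate[OF g, of "- (real j * ?a)"] by (simp add: distrib_right add_divide_distrib add.commute)
    then show ?thesis
    proof (rule has_integral_spike_finite[rotated 2])
      show "finite ((\<lambda>x. x + real j * ?a) ` insert 0 (insert ?a N))" using fin by simp
      fix \<phi> assume \<phi>: "\<phi> \<in> {real j * ?a..real (Suc j) * ?a} - (\<lambda>x. x + real j * ?a) ` insert 0 (insert ?a N)"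
      define \<psi> where "\<psi> = \<phi> - real j * ?a"
      have eq: "\<phi> = real j * ?a + \<psi>" by (simp add: \<psi>_def)
      have "0 \<le> \<psi>" "\<psi> \<le> ?a" using \<phi> by (auto simp: \<psi>_def algebra_simps add_divide_distrib)
      moreover have "\<psi> \<noteq> 0" "\<psi> \<noteq> ?a" "\<psi> \<notin> N" using \<phi> by (auto simp: eq)
      ultimately show "Q \<phi> = g (\<phi> + - (real j * ?a))"
        using gX[of \<psi>] by (auto simp: Q_def eq)
    qed
  qed
  \<comment> \<open>The integral \<open>J\<close> of \<open>\<bar>Q \<phi>\<bar>\<close> is
    auxiliary: positive parts are half sums of \<open>\<bar>Q \<phi>\<bar>\<close> and
    \<open>Q \<phi>\<close>, and \<open>J\<close> cancels when the lower ends are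
    subtracted.\<close>
  have "Q absolutely_integrable_on {real j * ?a..real (Suc j) * ?a}"
    by (rule absolutely_integrable_integrable_bound[where g = "\<lambda>_. max 0 R"])
       (use Q_bound QI in \<open>auto simp: integrable_on_def\<close>)
  then obtain J where QJ: "((\<lambda>\<phi>. \<bar>Q \<phi>\<bar>) has_integral J) {real j * ?a..real (Suc j) * ?a}"
    by (auto simp: absolutely_integrable_on_def integrable_on_def)
  have cells: "(Q has_integral real m * I) {real i * ?a..real (i + m) * ?a}"
      "((\<lambda>\<phi>. \<bar>Q \<phi>\<bar>) has_integral real m * J) {real i * ?a..real (i + m) * ?a}" for i m
    using has_integral_cells[of Q ?a, OF Q_per Q_even a QI]
      has_integral_cells[of "\<lambda>\<phi>. \<bar>Q \<phi>\<bar>" ?a, OF _ _ a QJ] Q_per Q_even by simp_all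
  have na: "real n * ?a = pi" using n by simp
  have 1: "((\<lambda>\<phi>. max 0 (Q \<phi>)) has_integral real n * (J + I)) {0..2 * pi}"
  proof -
    have "((\<lambda>\<phi>. 1/2 * (\<bar>Q \<phi>\<bar> + Q \<phi>)) has_integral 1/2 * (real (2 * n) * J + real (2 * n) * I))
        {real 0 * ?a..real (0 + 2 * n) * ?a}"
      by (intro has_integral_mult_right has_integral_add cells)
    moreover have "1/2 * (\<bar>Q \<phi>\<bar> + Q \<phi>) = max 0 (Q \<phi>)" for \<phi> by (simp add: max_def)
    ultimately show ?thesis using n by (simp add: algebra_simps)
  qed
  \<comment> \<open>The shift by \<pi> moves by exactly \<open>n\<close> cells, so the lower ends
    are again integrated over \<open>2 * n\<close> whole cells.\<close>
  have 2: "((\<lambda>\<phi>. max 0 (- Q (\<phi> + pi))) has_integral real n * (J - I)) {0..2 * pi}"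
  proof -
    have "((\<lambda>\<phi>. 1/2 * (\<bar>Q \<phi>\<bar> - Q \<phi>)) has_integral 1/2 * (real (2 * n) * J - real (2 * n) * I))
        {real n * ?a..real (n + 2 * n) * ?a}"
      by (intro has_integral_mult_right has_integral_diff cells)
    moreover have "1/2 * (\<bar>Q \<phi>\<bar> - Q \<phi>) = max 0 (- Q \<phi>)" for \<phi> by (simp add: max_def)
    ultimately have "((\<lambda>\<phi>. max 0 (- Q \<phi>)) has_integral 1/2 * (real (2 * n) * J - real (2 * n) * I))
        {real n * ?a..real (n + 2 * n) * ?a}"
      by (simp only:)
    then have "((\<lambda>\<phi>. max 0 (- Q \<phi>)) has_integral real n * (J - I)) {pi..3 * pi}"
      using n by (simp add: algebra_simps)
    from has_integral_translate[OF this, of pi] show ?thesis by simp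
  qed
  have 3: "((\<lambda>\<phi>. max 0 (Q \<phi>) - max 0 (- Q (\<phi> + pi))) has_integral 2 * real n * I) {0..2 * pi}"
    using has_integral_diff[OF 1 2] by (simp add: algebra_simps)
  have "((\<lambda>\<phi>. max 0 (Q \<phi>) - max 0 (- Q (\<phi> + pi))) has_integral 2 * real n * I) {0..<2 * pi}"
    by (rule has_integral_spike_set_eq[THEN iffD1, OF _ _ 3]; rule negligible_subset[of "{2 * pi}"]) auto
  note 4 = this
  have 5: "emeasure lborel {p \<in> X \<phi>. 0 \<le> p} = ennreal (max 0 (Q \<phi>) - max 0 (- Q (\<phi> + pi)))"
    and 6: "0 \<le> max 0 (Q \<phi>) - max 0 (- Q (\<phi> + pi))" for \<phi>
  proof -
    have *: "emeasure lborel {p \<in> X \<phi>. 0 \<le> p} = ennreal (max 0 (Q \<phi>) - max 0 (- Q (\<phi> + pi))) \<and>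
         0 \<le> max 0 (Q \<phi>) - max 0 (- Q (\<phi> + pi))"
    proof (cases "X \<phi> = {}")
      case True
      then show ?thesis using opp[of \<phi>] by (simp add: Q_def)
    next
      case False
      have "Inf (X \<phi>) = - Q (\<phi> + pi)"
        using False opp[of \<phi>] by (simp add: Q_def Inf_real_def)
      moreover have "Inf (X \<phi>) \<le> Sup (X \<phi>)"
        using False bd[of \<phi>] by (intro cInf_le_cSup bdd_aboveI[of _ R] bdd_belowI[of _ "-R"]) auto
      ultimately show ?thesis
        using emeasure_interval_nonneg_part[OF ivl False bd slice] False by (simp add: Q_def)
    qed
    show "emeasure lborel {p \<in> X \<phi>. 0 \<le> p} = ennreal (max 0 (Q \<phi>) - max 0 (- Q (\<phi> + pi)))"
      "0 \<le> max 0 (Q \<phi>) - max 0 (- Q (\<phi> + pi))" using * by auto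
  qed
  have "emeasure lborel ?A = emeasure (lborel \<Otimes>\<^sub>M lborel) ?A"
    by (simp add: lborel_prod)
  also have "\<dots> = (\<integral>\<^sup>+ \<phi>. emeasure lborel ((\<lambda>p. (p, \<phi>)) -` ?A) \<partial>lborel)"
    using A by (intro lborel_pair.emeasure_pair_measure_alt2) (simp only: lborel_prod sets_lborel)
  also have "\<dots> = (\<integral>\<^sup>+ \<phi>. ennreal (max 0 (Q \<phi>) - max 0 (- Q (\<phi> + pi))) * indicator {0..<2 * pi} \<phi> \<partial>lborel)"
  proof (rule nn_integral_cong)
    fix \<phi> :: real
    have "(\<lambda>p. (p, \<phi>)) -` ?A = (if \<phi> \<in> {0..<2 * pi} then {p \<in> X \<phi>. 0 \<le> p} else {})" by auto
    then show "emeasure lborel ((\<lambda>p. (p, \<phi>)) -` ?A) =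
        ennreal (max 0 (Q \<phi>) - max 0 (- Q (\<phi> + pi))) * indicator {0..<2 * pi} \<phi>"
      using 5[of \<phi>] by (simp add: indicator_def)
  qed
  also have "\<dots> = ennreal (2 * real n * I)"
    by (intro nn_integral_has_integral_lebesgue' 6 4)
  finally show "emeasure lborel ?A = ennreal (2 * real n * I)" .
  show "0 \<le> 2 * real n * I" by (rule has_integral_nonneg[OF 4 6])
qed

subsection \<open>Chords of the regular polygon\<close>

definition circ_pt :: "real \<Rightarrow> real \<Rightarrow> real \<times> real" where
  "circ_pt r x = (r * cos x, r * sin x)"

text \<open>Coordinates adapted to a line: \<open>p\<close> along the normal, \<open>t\<close> along
  the line as arc length.\<close>

definition line_pt :: "real \<Rightarrow> real \<Rightarrow> real \<Rightarrow> real \<times> real" where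
  "line_pt \<phi> p t = (p * cos \<phi> - t * sin \<phi>, p * sin \<phi> + t * cos \<phi>)"

text \<open>As a relation instead of a length function this is jointly convex in
  \<open>(p, \<sigma>)\<close>, which is the concavity of chord length. With
  \<open>\<sigma> = 0\<close> it expresses that the line meets the polygon.\<close>

definition has_chord :: "nat \<Rightarrow> real \<Rightarrow> real \<Rightarrow> real \<Rightarrow> real \<Rightarrow> bool" where
  "has_chord n r \<phi> p \<sigma> \<longleftrightarrow>
     (\<exists>t. line_pt \<phi> p t \<in> reg_polygon n r \<and> line_pt \<phi> p (t + \<sigma>) \<in> reg_polygon n r)"

definition long_chords :: "nat \<Rightarrow> real \<Rightarrow> real \<Rightarrow> real \<Rightarrow> real set" where
  "long_chords n r s \<phi> = {p. \<exists>\<sigma>>s. has_chord n r \<phi> p \<sigma>}"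

text \<open>With all integers as indices, rotations and reflections act on vertices by addition and
  sign change of the index, without reduction modulo \<open>n\<close>.\<close>

lemma reg_polygon_eq:
  assumes "0 < n"
  shows "reg_polygon n r = convex hull (range (\<lambda>j::int. circ_pt r (2 * of_int j * (pi / n))))"
proof -
  let ?v = "\<lambda>j::int. circ_pt r (2 * of_int j * (pi / n))"
  have "?v j \<in> poly_vertex n r ` {..<n}" for j
  proof -
    define m where "m = nat (j mod int n)"
    have m: "m < n" "int m = j mod int n" using assms by (auto simp: m_def nat_less_iff)
    then have "j = int m + (j div int n) * int n" by simp
    then have "real_of_int j = real m + of_int (j div int n) * real n"
      by (metis of_int_add of_int_mult of_int_of_nat_eq)
    then have "2 * of_int j * (pi / n) = 2 * pi * real m / n + of_int (j div int n) * (2 * pi)"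
      using assms by (simp add: field_simps)
    then have "?v j = poly_vertex n r m"
      using cos.plus_of_int[of "2 * pi * real m / n" "j div int n"]
        sin.plus_of_int[of "2 * pi * real m / n" "j div int n"]
      by (simp add: circ_pt_def poly_vertex_def)
    then show ?thesis using m by auto
  qed
  moreover have "poly_vertex n r i = ?v (int i)" for i
    by (simp add: circ_pt_def poly_vertex_def mult_ac)
  then have "poly_vertex n r ` {..<n} \<subseteq> range ?v" by (auto simp only: image_subset_iff rangeI)
  ultimately have "range ?v = poly_vertex n r ` {..<n}" by blast
  then show ?thesis by (simp add: reg_polygon_def)
qed

lemma vertex_in_reg_polygon:
  "0 < n \<Longrightarrow> circ_pt r (2 * of_int j * (pi / n)) \<in> reg_polygon n r"
  unfolding reg_polygon_eq by (rule hull_inc) (rule rangeI)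

lemma convex_reg_polygon: "convex (reg_polygon n r)"
  by (simp add: reg_polygon_def convex_convex_hull)

lemma compact_reg_polygon: "compact (reg_polygon n r)"
  unfolding reg_polygon_def by (intro finite_imp_compact_convex_hull) simp

lemma linear_image_in_reg_polygon:
  assumes "0 < n" "linear f" "x \<in> reg_polygon n r"
    and "\<And>j::int. \<exists>i::int. f (circ_pt r (2 * of_int j * (pi / n))) = circ_pt r (2 * of_int i * (pi / n))"
  shows "f x \<in> reg_polygon n r"
proof -
  let ?V = "range (\<lambda>j::int. circ_pt r (2 * of_int j * (pi / n)))"
  have "f x \<in> f ` (convex hull ?V)" using assms by (simp add: reg_polygon_eq)
  also have "\<dots> = convex hull (f ` ?V)" by (rule convex_hull_linear_image[OF assms(2)])
  also have "\<dots> \<subseteq> convex hull ?V"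
  proof (intro hull_mono image_subsetI, elim rangeE)
    fix x j assume "x = circ_pt r (2 * of_int j * (pi / n))"
    with assms(4)[of j] show "f x \<in> ?V" by (metis rangeI)
  qed
  finally show ?thesis using assms(1) by (simp add: reg_polygon_eq)
qed

lemma line_pt_norm: "(norm (line_pt \<phi> p t))\<^sup>2 = p\<^sup>2 + t\<^sup>2"
proof -
  have "(p * cos \<phi> - t * sin \<phi>)\<^sup>2 + (p * sin \<phi> + t * cos \<phi>)\<^sup>2
      = (p\<^sup>2 + t\<^sup>2) * ((sin \<phi>)\<^sup>2 + (cos \<phi>)\<^sup>2)"
    unfolding power2_eq_square by algebra
  then show ?thesis by (simp add: line_pt_def norm_Pair)
qed

lemma line_pt_convex:
  "(1 - u) *\<^sub>R line_pt \<phi> p t + u *\<^sub>R line_pt \<phi> p' t' = line_pt \<phi> ((1 - u) * p + u * p') ((1 - u) * t + u * t')"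
  by (simp add: line_pt_def algebra_simps)

lemma circ_pt_eq_line_pt: "circ_pt r x = line_pt \<phi> (r * cos (x - \<phi>)) (r * sin (x - \<phi>))"
proof -
  have "cos (x - \<phi>) * cos \<phi> - sin (x - \<phi>) * sin \<phi> = cos x" using cos_add[of "x - \<phi>" \<phi>] by simp
  moreover have "cos (x - \<phi>) * sin \<phi> + sin (x - \<phi>) * cos \<phi> = sin x"
    using sin_add[of "x - \<phi>" \<phi>] by simp
  ultimately show ?thesis by (simp add: circ_pt_def line_pt_def mult.assoc flip: distrib_left right_diff_distrib)
qed

lemma line_pphi_eq_range: "line_pphi p \<phi> = range (line_pt \<phi> p)"
proof (intro equalityI subsetI)
  fix z assume "z \<in> line_pphi p \<phi>"
  then obtain x y where z: "z = (x, y)" "p = x * cos \<phi> + y * sin \<phi>" by (auto simp: line_pphi_def)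
  have sc: "sin \<phi> * sin \<phi> + cos \<phi> * cos \<phi> = 1" using sin_cos_squared_add3[of \<phi>] by (simp add: add.commute)
  have "x = p * cos \<phi> - (y * cos \<phi> - x * sin \<phi>) * sin \<phi>" "y = p * sin \<phi> + (y * cos \<phi> - x * sin \<phi>) * cos \<phi>"
    using sc z(2) by algebra+
  then have "z = line_pt \<phi> p (y * cos \<phi> - x * sin \<phi>)"
    by (simp only: z(1) line_pt_def)
  then show "z \<in> range (line_pt \<phi> p)" by simp
next
  fix z assume "z \<in> range (line_pt \<phi> p)"
  then obtain t where z: "z = line_pt \<phi> p t" by auto
  have "(p * cos \<phi> - t * sin \<phi>) * cos \<phi> + (p * sin \<phi> + t * cos \<phi>) * sin \<phi> = p"
    using sin_cos_squared_add3[of \<phi>] by algebra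
  then show "z \<in> line_pphi p \<phi>" by (simp add: z line_pt_def line_pphi_def)
qed

lemma norm_line_pt_diff: "norm (line_pt \<phi> p t - line_pt \<phi> p t') = \<bar>t - t'\<bar>"
proof -
  have "line_pt \<phi> p t - line_pt \<phi> p t' = line_pt \<phi> 0 (t - t')" by (simp add: line_pt_def algebra_simps)
  then have "(norm (line_pt \<phi> p t - line_pt \<phi> p t'))\<^sup>2 = \<bar>t - t'\<bar>\<^sup>2" by (simp add: line_pt_norm)
  then show ?thesis by (rule power2_eq_imp_eq) simp_all
qed

lemma line_meets_iff: "line_pphi p \<phi> \<inter> reg_polygon n r \<noteq> {} \<longleftrightarrow> has_chord n r \<phi> p 0"
  by (auto simp: line_pphi_eq_range has_chord_def)

lemma diameter_chord_le_iff:
  assumes "0 \<le> s"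
  shows "diameter (line_pphi p \<phi> \<inter> reg_polygon n r) \<le> s \<longleftrightarrow> p \<notin> long_chords n r s \<phi>" (is "?L = ?R")
proof
  assume L: ?L
  show ?R
  proof
    assume "p \<in> long_chords n r s \<phi>"
    then obtain \<sigma> t where "s < \<sigma>" and
      in_chord: "line_pt \<phi> p t \<in> reg_polygon n r" "line_pt \<phi> p (t + \<sigma>) \<in> reg_polygon n r"
      by (auto simp: long_chords_def has_chord_def)
    have "bounded (line_pphi p \<phi> \<inter> reg_polygon n r)"
      using compact_imp_bounded[OF compact_reg_polygon] by blast
    then have "dist (line_pt \<phi> p (t + \<sigma>)) (line_pt \<phi> p t) \<le> diameter (line_pphi p \<phi> \<inter> reg_polygon n r)"
      using in_chord by (intro diameter_bounded_bound) (auto simp: line_pphi_eq_range)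
    then show False using L \<open>s < \<sigma>\<close> assms by (simp add: dist_norm norm_line_pt_diff)
  qed
next
  assume R: ?R
  show ?L
  proof (rule diameter_le)
    fix x y assume "x \<in> line_pphi p \<phi> \<inter> reg_polygon n r" "y \<in> line_pphi p \<phi> \<inter> reg_polygon n r"
    then obtain t t' where t: "x = line_pt \<phi> p t" "y = line_pt \<phi> p t'"
        "line_pt \<phi> p t \<in> reg_polygon n r" "line_pt \<phi> p t' \<in> reg_polygon n r"
      by (auto simp: line_pphi_eq_range)
    then have "has_chord n r \<phi> p \<bar>t - t'\<bar>"
      unfolding has_chord_def by (cases "t \<le> t'") (auto intro: exI[of _ t] exI[of _ t'])
    then show "norm (x - y) \<le> s" using R by (force simp: t norm_line_pt_diff long_chords_def not_less[symmetric])
  qed (use assms in simp)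
qed

lemma has_chord_convex:
  assumes "has_chord n r \<phi> p \<sigma>" "has_chord n r \<phi> p' \<sigma>'" "0 \<le> u" "u \<le> 1"
  shows "has_chord n r \<phi> ((1 - u) * p + u * p') ((1 - u) * \<sigma> + u * \<sigma>')"
proof -
  obtain t t' where "line_pt \<phi> p t \<in> reg_polygon n r" "line_pt \<phi> p (t + \<sigma>) \<in> reg_polygon n r"
    "line_pt \<phi> p' t' \<in> reg_polygon n r" "line_pt \<phi> p' (t' + \<sigma>') \<in> reg_polygon n r"
    using assms by (auto simp: has_chord_def)
  moreover have "(1 - u) *\<^sub>R x + u *\<^sub>R y \<in> reg_polygon n r"
    if "x \<in> reg_polygon n r" "y \<in> reg_polygon n r" for x y
    using that assms convexD_alt[OF convex_reg_polygon] by blast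
  ultimately have
    "line_pt \<phi> ((1 - u) * p + u * p') ((1 - u) * t + u * t') \<in> reg_polygon n r"
    "line_pt \<phi> ((1 - u) * p + u * p') ((1 - u) * (t + \<sigma>) + u * (t' + \<sigma>')) \<in> reg_polygon n r"
    by (metis line_pt_convex)+
  moreover have "(1 - u) * (t + \<sigma>) + u * (t' + \<sigma>') = ((1 - u) * t + u * t') + ((1 - u) * \<sigma> + u * \<sigma>')"
    by (simp add: algebra_simps)
  ultimately show ?thesis unfolding has_chord_def by metis
qed

text \<open>Convexity used on a single line, between the chord of length 0 and the given
  one.\<close>

lemma has_chord_mono:
  assumes "has_chord n r \<phi> p \<sigma>" "0 \<le> \<sigma>'" "\<sigma>' \<le> \<sigma>"
  shows "has_chord n r \<phi> p \<sigma>'"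
proof (cases "\<sigma> = 0")
  case False
  have "has_chord n r \<phi> p 0" using assms(1) by (auto simp: has_chord_def)
  from has_chord_convex[OF this assms(1), of "\<sigma>' / \<sigma>"] show ?thesis
    using assms False by (simp add: field_simps)
qed (use assms in auto)

lemma is_interval_long_chords: "is_interval (long_chords n r s \<phi>)"
  unfolding is_interval_convex_1
proof (rule convexI)
  fix x y u v :: real
  assume "x \<in> long_chords n r s \<phi>" "y \<in> long_chords n r s \<phi>" and uv: "0 \<le> u" "0 \<le> v" "u + v = 1"
  then obtain \<sigma> \<sigma>' where c: "s < \<sigma>" "s < \<sigma>'" "has_chord n r \<phi> x \<sigma>" "has_chord n r \<phi> y \<sigma>'"
    by (auto simp: long_chords_def)
  have "has_chord n r \<phi> ((1 - v) * x + v * y) ((1 - v) * \<sigma> + v * \<sigma>')"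
    using has_chord_convex c uv by simp
  moreover have "s < (1 - v) * \<sigma> + v * \<sigma>'"
    using convex_bound_lt[of "- \<sigma>" "- s" "- \<sigma>'" u v] c uv by (simp add: eq_diff_eq[symmetric])
  moreover have "u = 1 - v" using uv by simp
  ultimately show "u *\<^sub>R x + v *\<^sub>R y \<in> long_chords n r s \<phi>"
    by (auto simp: long_chords_def)
qed

lemma is_interval_meeting_lines: "is_interval {p. has_chord n r \<phi> p 0}"
  unfolding is_interval_convex_1
proof (rule convexI)
  fix x y u v :: real
  assume "x \<in> {p. has_chord n r \<phi> p 0}" "y \<in> {p. has_chord n r \<phi> p 0}" "0 \<le> u" "0 \<le> v" "u + v = 1"
  then show "u *\<^sub>R x + v *\<^sub>R y \<in> {p. has_chord n r \<phi> p 0}"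
    using has_chord_convex[of n r \<phi> x 0 y 0 v] by (simp add: eq_diff_eq[symmetric])
qed

lemma norm_reg_polygon_le:
  assumes "x \<in> reg_polygon n r" "0 \<le> r"
  shows "norm x \<le> r"
proof -
  have "reg_polygon n r \<subseteq> cball 0 r"
    unfolding reg_polygon_def
  proof (rule hull_minimal)
    have "(r * cos y)\<^sup>2 + (r * sin y)\<^sup>2 = r\<^sup>2" for y
      by (simp add: power_mult_distrib flip: distrib_left)
    then show "poly_vertex n r ` {..<n} \<subseteq> cball 0 r"
      using assms by (auto simp: poly_vertex_def norm_Pair)
  qed simp
  then show ?thesis using assms by auto
qed

lemma line_pt_in_reg_polygon_bound:
  assumes "line_pt \<phi> p t \<in> reg_polygon n r" "0 \<le> r"
  shows "\<bar>p\<bar> \<le> r" "\<bar>t\<bar> \<le> r"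
proof -
  have "p\<^sup>2 + t\<^sup>2 \<le> r\<^sup>2"
    using norm_reg_polygon_le[OF assms] line_pt_norm[of \<phi> p t] by (metis norm_ge_zero power_mono)
  then have "p\<^sup>2 \<le> r\<^sup>2" "t\<^sup>2 \<le> r\<^sup>2"
    using zero_le_power2[of p] zero_le_power2[of t] by linarith+
  then show "\<bar>p\<bar> \<le> r" "\<bar>t\<bar> \<le> r" using assms(2) abs_le_square_iff[of _ r] by auto
qed

lemma has_chord_bound: "has_chord n r \<phi> p \<sigma> \<Longrightarrow> 0 \<le> r \<Longrightarrow> p \<in> {-r..r}"
  using line_pt_in_reg_polygon_bound(1) by (fastforce simp: has_chord_def)

section \<open>Measurability in the line parameters\<close>

lemma closed_has_chord:
  assumes "0 \<le> r"
  shows "closed {(p, \<phi>). has_chord n r \<phi> p \<sigma>}"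
proof -
  \<comment> \<open>The chord position \<open>t\<close> is confined to the compact interval
    \<open>{-r..r}\<close>, so the relation is the projection of a closed set along a compact
    factor.\<close>
  let ?T = "{z. line_pt (snd (snd z)) (fst (snd z)) (fst z) \<in> reg_polygon n r}
      \<inter> {z. line_pt (snd (snd z)) (fst (snd z)) (fst z + \<sigma>) \<in> reg_polygon n r} :: (real \<times> real \<times> real) set"
  have "continuous_on UNIV (\<lambda>z :: real \<times> real \<times> real. line_pt (snd (snd z)) (fst (snd z)) (fst z + c))" for c
    unfolding line_pt_def by (intro continuous_intros)
  then have "closed {z :: real \<times> real \<times> real. line_pt (snd (snd z)) (fst (snd z)) (fst z + c) \<in> reg_polygon n r}" for c
    by (rule closed_vimage[OF compact_imp_closed[OF compact_reg_polygon], unfolded vimage_def])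
  from this[of 0] this[of \<sigma>] have "closed ?T" by (intro closed_Int) simp_all
  then have "closed {y. \<exists>x. x \<in> {-r..r} \<and> (x, y) \<in> ?T}"
    by (intro closed_compact_projection) simp_all
  moreover have "{(p, \<phi>). has_chord n r \<phi> p \<sigma>} = {y. \<exists>x. x \<in> {-r..r} \<and> (x, y) \<in> ?T}"
  proof (rule set_eqI)
    fix z :: "real \<times> real"
    obtain p \<phi> where z: "z = (p, \<phi>)" by (cases z)
    have "t \<in> {-r..r}" if "line_pt \<phi> p t \<in> reg_polygon n r" for t
      using line_pt_in_reg_polygon_bound(2)[OF that assms] by (simp add: abs_le_iff)
    then show "z \<in> {(p, \<phi>). has_chord n r \<phi> p \<sigma>} \<longleftrightarrow> z \<in> {y. \<exists>x. x \<in> {-r..r} \<and> (x, y) \<in> ?T}"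
      unfolding z has_chord_def by (simp del: atLeastAtMost_iff) blast
  qed
  ultimately show ?thesis by simp
qed

lemma borel_long_chords:
  assumes "0 \<le> r" "0 \<le> s"
  shows "{(p, \<phi>). p \<in> long_chords n r s \<phi>} \<in> sets borel"
proof -
  \<comment> \<open>The strict bound is exhausted by the lengths
    \<open>s + 1 / real (Suc m)\<close>, which gives a countable union of closed sets.\<close>
  have "{(p, \<phi>). p \<in> long_chords n r s \<phi>} = (\<Union>m. {(p, \<phi>). has_chord n r \<phi> p (s + 1 / real (Suc m))})"
  proof (intro equalityI subsetI)
    fix z assume "z \<in> {(p, \<phi>). p \<in> long_chords n r s \<phi>}"
    then obtain p \<phi> \<sigma> where z: "z = (p, \<phi>)" "s < \<sigma>" "has_chord n r \<phi> p \<sigma>"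
      by (auto simp: long_chords_def)
    obtain m where "1 / real (Suc m) < \<sigma> - s" using nat_approx_posE[of "\<sigma> - s"] z(2) by auto
    then have "has_chord n r \<phi> p (s + 1 / real (Suc m))"
      using assms by (intro has_chord_mono[OF z(3)]) auto
    then show "z \<in> (\<Union>m. {(p, \<phi>). has_chord n r \<phi> p (s + 1 / real (Suc m))})" using z by auto
  next
    fix z assume "z \<in> (\<Union>m. {(p, \<phi>). has_chord n r \<phi> p (s + 1 / real (Suc m))})"
    then obtain m where "has_chord n r (snd z) (fst z) (s + 1 / real (Suc m))" by auto
    then have "fst z \<in> long_chords n r s (snd z)"
      unfolding long_chords_def by (intro CollectI exI[of _ "s + 1 / real (Suc m)"]) simp
    then show "z \<in> {(p, \<phi>). p \<in> long_chords n r s \<phi>}" by (simp add: case_prod_unfold)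
  qed
  then show ?thesis using closed_has_chord[OF assms(1)] by (auto intro!: sets.countable_UN borel_closed)
qed

section \<open>Symmetries of the polygon acting on chords\<close>

lemma has_chord_rot:
  assumes "0 < n"
  shows "has_chord n r (\<phi> + 2 * of_int j * (pi / n)) p \<sigma> \<longleftrightarrow> has_chord n r \<phi> p \<sigma>"
proof -
  have *: "line_pt (\<phi> + 2 * of_int i * (pi / n)) p t \<in> reg_polygon n r"
    if "line_pt \<phi> p t \<in> reg_polygon n r" for i :: int and t \<phi>
  proof -
    let ?d = "2 * of_int i * (pi / n)"
    let ?f = "\<lambda>(x, y). (x * cos ?d - y * sin ?d, x * sin ?d + y * cos ?d)"
    have lin: "linear ?f" by (intro linearI) (auto simp: algebra_simps)
    have vert: "?f (circ_pt r (2 * of_int k * (pi / n))) = circ_pt r (2 * of_int (k + i) * (pi / n))" for k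
    proof -
      have "2 * of_int (k + i) * (pi / n) = 2 * of_int k * (pi / n) + ?d" by (simp add: algebra_simps add_divide_distrib)
      then show ?thesis unfolding circ_pt_def by (simp only: cos_add sin_add) (simp add: algebra_simps)
    qed
    have "?f (line_pt \<phi> p t) \<in> reg_polygon n r"
      by (rule linear_image_in_reg_polygon[OF assms lin that]) (rule exI, rule vert)
    moreover have "?f (line_pt \<phi> p t) = line_pt (\<phi> + ?d) p t"
      unfolding line_pt_def by (simp only: cos_add sin_add) (simp add: algebra_simps)
    ultimately show ?thesis by simp
  qed
  have "line_pt (\<phi> + 2 * of_int j * (pi / n)) p t \<in> reg_polygon n r \<longleftrightarrow> line_pt \<phi> p t \<in> reg_polygon n r" for t
    using *[of \<phi> t j] *[of "\<phi> + 2 * of_int j * (pi / n)" t "- j"] by auto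
  then show ?thesis by (simp only: has_chord_def)
qed

lemma has_chord_reflect:
  assumes "0 < n"
  shows "has_chord n r (- \<phi>) p \<sigma> \<longleftrightarrow> has_chord n r \<phi> p \<sigma>"
proof -
  have *: "line_pt (- \<phi>) p (- t) \<in> reg_polygon n r" if "line_pt \<phi> p t \<in> reg_polygon n r" for t \<phi>
  proof -
    let ?f = "\<lambda>(x :: real, y :: real). (x, - y)"
    have lin: "linear ?f" by (rule linearI) (simp_all add: case_prod_unfold)
    have vert: "?f (circ_pt r (2 * of_int k * (pi / n))) = circ_pt r (2 * of_int (- k) * (pi / n))" for k
      by (simp add: circ_pt_def)
    have "?f (line_pt \<phi> p t) \<in> reg_polygon n r"
      by (rule linear_image_in_reg_polygon[OF assms lin that]) (rule exI, rule vert)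
    then show ?thesis by (simp add: line_pt_def)
  qed
  have "has_chord n r (- \<phi>) p \<sigma>" if chord: "has_chord n r \<phi> p \<sigma>" for \<phi>
  proof -
    obtain t where t: "line_pt \<phi> p t \<in> reg_polygon n r" "line_pt \<phi> p (t + \<sigma>) \<in> reg_polygon n r"
      using chord by (auto simp: has_chord_def)
    \<comment> \<open>The reflection reverses the direction of the line, so the image chord starts
      at the image of the old end, \<open>- t - \<sigma>\<close>.\<close>
    then show ?thesis using *[OF t(1)] *[OF t(2)] by (auto simp: has_chord_def intro!: exI[of _ "- t - \<sigma>"])
  qed
  from this[of \<phi>] this[of "- \<phi>"] show ?thesis by auto
qed

lemma has_chord_opposite: "has_chord n r (\<phi> + pi) (- p) \<sigma> \<longleftrightarrow> has_chord n r \<phi> p \<sigma>"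
proof -
  have *: "line_pt (\<phi> + pi) (- p) t = line_pt \<phi> p (- t)" for t by (simp add: line_pt_def)
  show ?thesis
  proof
    assume "has_chord n r (\<phi> + pi) (- p) \<sigma>"
    then show "has_chord n r \<phi> p \<sigma>" unfolding has_chord_def *
      by (metis add.commute add_diff_cancel_left' diff_minus_eq_add minus_add_distrib minus_diff_eq)
  next
    assume "has_chord n r \<phi> p \<sigma>"
    then obtain t where "line_pt \<phi> p t \<in> reg_polygon n r" "line_pt \<phi> p (t + \<sigma>) \<in> reg_polygon n r"
      by (auto simp: has_chord_def)
    then show "has_chord n r (\<phi> + pi) (- p) \<sigma>" unfolding has_chord_def *
      by (intro exI[of _ "- t - \<sigma>"]) (simp add: add.commute)
  qed
qed

section \<open>Supporting half planes and sides\<close>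

lemma cos_odd_multiple_le:
  fixes a :: int
  assumes "odd a" "0 < n"
  shows "cos (of_int a * (pi / real n)) \<le> cos (pi / real n)"
proof -
  define b where "b = a mod (2 * int n)"
  have "odd b" using assms by (simp add: b_def mod_mod_cancel even_iff_mod_2_eq_zero[symmetric] dvd_mod_iff)
  have b: "0 \<le> b" "b < 2 * int n" using assms by (auto simp: b_def)
  have "b \<noteq> 0" using \<open>odd b\<close> by auto
  with b have b1: "1 \<le> b" "b \<le> 2 * int n - 1" by auto
  have "a = b + (a div (2 * int n)) * (2 * int n)" unfolding b_def by (rule mod_div_mult_eq[symmetric])
  from arg_cong[OF this, of real_of_int]
  have "real_of_int a = of_int b + of_int (a div (2 * int n)) * (2 * real n)"
    by (simp only: of_int_add of_int_mult of_int_of_nat_eq of_int_numeral)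
  then have "of_int a * (pi / n) = of_int b * (pi / n) + of_int (a div (2 * int n)) * (2 * pi)"
    using assms by (simp add: field_simps)
  then have ab: "cos (of_int a * (pi / n)) = cos (of_int b * (pi / n))"
    using cos.plus_of_int[of "of_int b * (pi / n)" "a div (2 * int n)"] by simp
  have *: "cos (of_int c * (pi / n)) \<le> cos (pi / n)" if "1 \<le> c" "c \<le> int n" for c :: int
  proof (rule cos_monotone_0_pi_le)
    show "pi / n \<le> of_int c * (pi / n)" using that by (simp add: field_simps)
    have "real_of_int c \<le> real n" using that by linarith
    then show "of_int c * (pi / n) \<le> pi" using assms by (simp add: field_simps)
  qed simp
  show ?thesis
  proof (cases "b \<le> int n")
    case False
    have "of_int b * (pi / n) = 2 * pi - of_int (2 * int n - b) * (pi / n)"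
      using assms by (simp add: field_simps)
    then have "cos (of_int b * (pi / n)) = cos (of_int (2 * int n - b) * (pi / n))"
      by (simp only: cos_diff) simp
    then show ?thesis using False b1 ab *[of "2 * int n - b"] by simp
  qed (use b1 ab * in simp)
qed

text \<open>Measured from the outer normal of a side, every vertex sits at an odd multiple of \<pi>
  / n, so its projection is at most \<open>r * cos (pi / n)\<close>. The inequality is then read in
  the coordinates of the given line.\<close>

lemma reg_polygon_half_plane:
  assumes "0 < n" "0 \<le> r" "line_pt \<phi> p t \<in> reg_polygon n r"
  shows "p * cos (of_int (2 * j + 1) * (pi / n) - \<phi>) + t * sin (of_int (2 * j + 1) * (pi / n) - \<phi>)
      \<le> r * cos (pi / n)"
proof -
  let ?g = "of_int (2 * j + 1) * (pi / n)"
  let ?H = "{x. inner (cos ?g, sin ?g) x \<le> r * cos (pi / n)}"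
  have "circ_pt r (2 * of_int i * (pi / n)) \<in> ?H" for i :: int
  proof -
    have "inner (cos ?g, sin ?g) (circ_pt r (2 * of_int i * (pi / n))) = r * cos (2 * of_int i * (pi / n) - ?g)"
      by (simp add: circ_pt_def cos_diff algebra_simps)
    also have "2 * of_int i * (pi / n) - ?g = of_int (2 * (i - j) - 1) * (pi / n)"
      by (simp add: algebra_simps diff_divide_distrib add_divide_distrib)
    also have "r * cos \<dots> \<le> r * cos (pi / n)"
      using assms cos_odd_multiple_le[of "2 * (i - j) - 1" n] by (intro mult_left_mono) auto
    finally show ?thesis by simp
  qed
  then have "reg_polygon n r \<subseteq> ?H"
    unfolding reg_polygon_eq[OF assms(1)] by (intro hull_minimal convex_halfspace_le) auto
  then have "inner (cos ?g, sin ?g) (line_pt \<phi> p t) \<le> r * cos (pi / n)" using assms by auto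
  moreover have "inner (cos ?g, sin ?g) (line_pt \<phi> p t) = p * cos (?g - \<phi>) + t * sin (?g - \<phi>)"
    unfolding line_pt_def cos_diff sin_diff by (simp add: algebra_simps)
  ultimately show ?thesis by simp
qed

text \<open>The convex combination of the two end points that has the right projection
  \<open>p\<close> lies on the side; the equation is the equality case of
  \<open>reg_polygon_half_plane\<close>.\<close>

lemma line_meets_side:
  assumes "0 < n"
    and p: "p \<in> closed_segment (r * cos (2 * of_int j * (pi / n) - \<phi>)) (r * cos (2 * of_int (j + 1) * (pi / n) - \<phi>))"
  shows "\<exists>t. line_pt \<phi> p t \<in> reg_polygon n r \<and>
      p * cos (of_int (2 * j + 1) * (pi / n) - \<phi>) + t * sin (of_int (2 * j + 1) * (pi / n) - \<phi>)
      = r * cos (pi / n)"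
proof -
  let ?g = "of_int (2 * j + 1) * (pi / n)"
  define x where "x i = 2 * of_int i * (pi / n)" for i :: int
  obtain u where u: "0 \<le> u" "u \<le> 1" "p = (1 - u) * (r * cos (x j - \<phi>)) + u * (r * cos (x (j + 1) - \<phi>))"
    using p by (auto simp: in_segment x_def)
  define t where "t = (1 - u) * (r * sin (x j - \<phi>)) + u * (r * sin (x (j + 1) - \<phi>))"
  have "line_pt \<phi> p t = (1 - u) *\<^sub>R circ_pt r (x j) + u *\<^sub>R circ_pt r (x (j + 1))"
    by (simp add: circ_pt_eq_line_pt[of r _ \<phi>] line_pt_convex u t_def)
  moreover have "circ_pt r (x i) \<in> reg_polygon n r" for i
    using vertex_in_reg_polygon[OF assms(1), of r i] by (simp add: x_def)
  ultimately have 1: "line_pt \<phi> p t \<in> reg_polygon n r"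
    using u convexD_alt[OF convex_reg_polygon] by simp
  have side: "cos (y - \<phi>) * cos (?g - \<phi>) + sin (y - \<phi>) * sin (?g - \<phi>) = cos (y - ?g)" for y
    using cos_diff[of "y - \<phi>" "?g - \<phi>"] by simp
  have e: "x j - ?g = - (pi / n)" "x (j + 1) - ?g = pi / n"
    by (simp_all add: x_def algebra_simps add_divide_distrib)
  have "p * cos (?g - \<phi>) + t * sin (?g - \<phi>)
      = (1 - u) * r * (cos (x j - \<phi>) * cos (?g - \<phi>) + sin (x j - \<phi>) * sin (?g - \<phi>))
        + u * r * (cos (x (j + 1) - \<phi>) * cos (?g - \<phi>) + sin (x (j + 1) - \<phi>) * sin (?g - \<phi>))"
    by (simp add: u(3) t_def algebra_simps)
  also have "\<dots> = (1 - u) * r * cos (pi / n) + u * r * cos (pi / n)"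
    by (simp only: side e cos_minus)
  finally have "p * cos (?g - \<phi>) + t * sin (?g - \<phi>) = r * cos (pi / n)" by (simp add: algebra_simps)
  with 1 show ?thesis by blast
qed

subsection \<open>Chords between two sides\<close>

text \<open>This factorization turns the wedge length at a vertex into a product of sines; with
  \<open>- \<beta>\<close> and \<open>- \<psi>\<close> it serves the other vertex as well.\<close>

lemma cos_cos_minus_cos_cos:
  fixes \<beta> \<kappa> \<psi> :: real
  shows "cos \<beta> * cos \<psi> - cos \<kappa> * cos (\<kappa> + \<beta> - \<psi>) = sin (\<kappa> + \<beta>) * sin (\<kappa> - \<psi>)"
proof -
  have "cos (\<psi> - \<beta>) = cos (\<beta> - \<psi>)" by (metis cos_minus minus_diff_eq)
  then show ?thesis unfolding cos_times_cos sin_times_sin by (simp add: algebra_simps add_divide_distrib)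
qed

definition upper_end :: "nat \<Rightarrow> real \<Rightarrow> real \<Rightarrow> nat \<Rightarrow> real \<Rightarrow> real" where
  "upper_end n r s k \<psi> = r * cos (pi / n) * cos \<psi> / cos (real k * (pi / n))
     - s * ((cos \<psi>)\<^sup>2 - (cos (real k * (pi / n)))\<^sup>2) / sin (2 * (real k * (pi / n)))"

text \<open>The line with normal direction \<open>\<phi> = (k + 1) \<beta> + \<psi>\<close> is compared with the two sides of the
  polygon whose outer normals have the directions \<open>\<beta>\<close> and \<open>(2 k + 1) \<beta>\<close>. These sides are offset by
  \<open>k\<close>, and their normals are symmetric about \<open>(k + 1) \<beta>\<close>, at distance \<open>\<kappa>\<close>.\<close>
context
  fixes n k :: nat and r \<psi> \<beta> \<kappa> \<phi> :: real
  assumes n: "3 \<le> n" and r: "0 < r" and k: "1 \<le> k" "2 * k \<le> n"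
    and \<beta>: "\<beta> = pi / n" and \<kappa>: "\<kappa> = real k * \<beta>" and \<phi>: "\<phi> = real (Suc k) * \<beta> + \<psi>"
    and \<psi>: "0 < \<psi>" "\<psi> < \<beta>"
begin

lemma wedge_angles: "0 < \<beta>" "\<beta> < pi / 2" "\<beta> \<le> \<kappa>" "\<kappa> \<le> pi / 2" "\<kappa> + \<beta> < pi"
proof -
  have npos: "0 < real n" using n by simp
  show "0 < \<beta>" using npos by (simp add: \<beta>)
  have "real 3 \<le> real n" using n by (simp only: of_nat_le_iff)
  then have b3: "\<beta> \<le> pi / 3" unfolding \<beta> by (intro divide_left_mono) auto
  then show "\<beta> < pi / 2" using pi_gt_zero by linarith
  show "\<beta> \<le> \<kappa>" using k(1) \<open>0 < \<beta>\<close> by (simp add: \<kappa>)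
  have "real (2 * k) \<le> real n" using k(2) by (simp only: of_nat_le_iff)
  then have "2 * real k * pi \<le> real n * pi" by (intro mult_right_mono) auto
  then show k2: "\<kappa> \<le> pi / 2" using npos by (simp add: \<kappa> \<beta> field_simps)
  show "\<kappa> + \<beta> < pi" using b3 k2 pi_gt_zero by linarith
qed

lemma wedge_sines_pos: "0 < sin (\<kappa> - \<psi>)" "0 < sin (\<kappa> + \<psi>)" "0 < sin \<kappa>" "0 < sin (\<kappa> + \<beta>)"
  using wedge_angles \<psi> by (auto intro!: sin_gt_zero)

lemma wedge_normals:
  "of_int (2 * int k + 1) * (pi / n) - \<phi> = \<kappa> - \<psi>"
  "of_int (2 * 0 + 1) * (pi / n) - \<phi> = - (\<kappa> + \<psi>)"
  by (simp_all add: \<phi> \<kappa> \<beta> algebra_simps add_divide_distrib)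

text \<open>Each side equation is weighted by the sine belonging to the other side, so that the end
  points enter only through \<open>t' - t\<close>, the chord length.\<close>

lemma wedge_combine:
  "(p * cos (\<kappa> - \<psi>) + t' * sin (\<kappa> - \<psi>)) * sin (\<kappa> + \<psi>) +
   (p * cos (- (\<kappa> + \<psi>)) + t * sin (- (\<kappa> + \<psi>))) * sin (\<kappa> - \<psi>)
   = (t' - t) * (sin (\<kappa> - \<psi>) * sin (\<kappa> + \<psi>)) + p * sin (2 * \<kappa>)"
proof -
  have "sin (2 * \<kappa>) = sin (\<kappa> + \<psi>) * cos (\<kappa> - \<psi>) + cos (\<kappa> + \<psi>) * sin (\<kappa> - \<psi>)"
    using sin_add[of "\<kappa> + \<psi>" "\<kappa> - \<psi>"] by (simp add: mult_2[symmetric])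
  then show ?thesis unfolding cos_minus sin_minus by (simp only: ring_distribs mult_ac minus_mult_left[symmetric] mult_minus_right)
qed

lemma sin_plus_sin_wedge: "sin (\<kappa> + \<psi>) + sin (\<kappa> - \<psi>) = 2 * sin \<kappa> * cos \<psi>"
  by (simp add: sin_add sin_diff)

text \<open>Both end points satisfy the half plane inequalities of the two chosen sides, whichever
  sides the chord really meets; the wedge length therefore bounds every chord.\<close>

lemma wedge_chord_le:
  assumes "has_chord n r \<phi> p \<sigma>"
  shows "\<sigma> * (sin (\<kappa> - \<psi>) * sin (\<kappa> + \<psi>)) + p * sin (2 * \<kappa>) \<le> 2 * r * cos \<beta> * sin \<kappa> * cos \<psi>"
proof -
  obtain t where t: "line_pt \<phi> p t \<in> reg_polygon n r" "line_pt \<phi> p (t + \<sigma>) \<in> reg_polygon n r"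
    using assms by (auto simp: has_chord_def)
  have "0 < n" using n by simp
  note half = reg_polygon_half_plane[OF this less_imp_le[OF r]]
  have 1: "p * cos (\<kappa> - \<psi>) + (t + \<sigma>) * sin (\<kappa> - \<psi>) \<le> r * cos \<beta>"
    using half[OF t(2), of "int k"] unfolding wedge_normals \<beta> .
  have 2: "p * cos (- (\<kappa> + \<psi>)) + t * sin (- (\<kappa> + \<psi>)) \<le> r * cos \<beta>"
    using half[OF t(1), of 0] unfolding wedge_normals \<beta> .
  have "(p * cos (\<kappa> - \<psi>) + (t + \<sigma>) * sin (\<kappa> - \<psi>)) * sin (\<kappa> + \<psi>) +
      (p * cos (- (\<kappa> + \<psi>)) + t * sin (- (\<kappa> + \<psi>))) * sin (\<kappa> - \<psi>)
      \<le> r * cos \<beta> * sin (\<kappa> + \<psi>) + r * cos \<beta> * sin (\<kappa> - \<psi>)"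
    using 1 2 wedge_sines_pos by (intro add_mono mult_right_mono) auto
  also have "\<dots> = r * cos \<beta> * (2 * sin \<kappa> * cos \<psi>)"
    unfolding sin_plus_sin_wedge[symmetric] by (rule distrib_left[symmetric])
  finally show ?thesis unfolding wedge_combine by (simp add: mult_ac)
qed

text \<open>The bounds on \<open>p\<close> describe the overlap of the projections of the two sides.
  Its ends are the projections of the vertices at the angles
  \<open>\<kappa> + \<beta> - \<psi>\<close> and \<open>\<kappa> - \<beta> + \<psi>\<close> from the
  normal, and in between the line really crosses both sides.\<close>

lemma wedge_chord_exists:
  assumes p: "r * cos (\<kappa> + \<beta> - \<psi>) \<le> p" "p \<le> r * cos (\<kappa> - \<beta> + \<psi>)"
    and \<sigma>: "\<sigma> * (sin (\<kappa> - \<psi>) * sin (\<kappa> + \<psi>)) + p * sin (2 * \<kappa>) = 2 * r * cos \<beta> * sin \<kappa> * cos \<psi>"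
  shows "has_chord n r \<phi> p \<sigma>"
proof -
  have "0 < n" using n by simp
  have ang: "2 * of_int (int k) * (pi / n) - \<phi> = \<kappa> - \<beta> - \<psi>"
    "2 * of_int (int k + 1) * (pi / n) - \<phi> = \<kappa> + \<beta> - \<psi>"
    "2 * of_int 0 * (pi / n) - \<phi> = - (\<kappa> + \<beta> + \<psi>)"
    "2 * of_int (0 + 1) * (pi / n) - \<phi> = - (\<kappa> - \<beta> + \<psi>)"
    by (simp_all add: \<phi> \<kappa> \<beta> algebra_simps add_divide_distrib)
  have "cos (\<kappa> - \<beta> + \<psi>) \<le> cos (\<kappa> - \<beta> - \<psi>)"
  proof -
    have "cos (\<kappa> - \<beta> - \<psi>) - cos (\<kappa> - \<beta> + \<psi>) = 2 * (sin (\<kappa> - \<beta>) * sin \<psi>)"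
      by (simp add: cos_add cos_diff)
    moreover have "0 \<le> sin (\<kappa> - \<beta>) * sin \<psi>"
      using wedge_angles \<psi> by (intro mult_nonneg_nonneg sin_ge_zero) auto
    ultimately show ?thesis by linarith
  qed
  then have "r * cos (\<kappa> - \<beta> + \<psi>) \<le> r * cos (\<kappa> - \<beta> - \<psi>)" using r by simp
  then have "p \<in> closed_segment (r * cos (\<kappa> - \<beta> - \<psi>)) (r * cos (\<kappa> + \<beta> - \<psi>))"
    using p by (simp add: closed_segment_eq_real_ivl)
  with line_meets_side[OF \<open>0 < n\<close>, of p r "int k" \<phi>] obtain t' where
    t': "line_pt \<phi> p t' \<in> reg_polygon n r" "p * cos (\<kappa> - \<psi>) + t' * sin (\<kappa> - \<psi>) = r * cos \<beta>"
    unfolding ang wedge_normals by (auto simp: \<beta>)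
  have "cos (\<kappa> + \<beta> + \<psi>) \<le> cos (\<kappa> + \<beta> - \<psi>)"
  proof -
    have "cos (\<kappa> + \<beta> - \<psi>) - cos (\<kappa> + \<beta> + \<psi>) = 2 * (sin (\<kappa> + \<beta>) * sin \<psi>)"
      by (simp add: cos_add[of "\<kappa> + \<beta>"] cos_diff)
    moreover have "0 \<le> sin (\<kappa> + \<beta>) * sin \<psi>"
      using wedge_angles \<psi> by (intro mult_nonneg_nonneg sin_ge_zero) auto
    ultimately show ?thesis by linarith
  qed
  then have "r * cos (\<kappa> + \<beta> + \<psi>) \<le> r * cos (\<kappa> + \<beta> - \<psi>)" using r by simp
  then have "p \<in> closed_segment (r * cos (- (\<kappa> + \<beta> + \<psi>))) (r * cos (- (\<kappa> - \<beta> + \<psi>)))"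
    using p unfolding cos_minus by (simp add: closed_segment_eq_real_ivl)
  with line_meets_side[OF \<open>0 < n\<close>, of p r 0 \<phi>] obtain t where
    t: "line_pt \<phi> p t \<in> reg_polygon n r" "p * cos (- (\<kappa> + \<psi>)) + t * sin (- (\<kappa> + \<psi>)) = r * cos \<beta>"
    unfolding ang wedge_normals by (auto simp: \<beta>)
  have "(t' - t) * (sin (\<kappa> - \<psi>) * sin (\<kappa> + \<psi>)) + p * sin (2 * \<kappa>)
      = r * cos \<beta> * (sin (\<kappa> + \<psi>) + sin (\<kappa> - \<psi>))"
    using wedge_combine[of p t' t] unfolding t(2) t'(2) by (simp add: distrib_left)
  also have "\<dots> = 2 * r * cos \<beta> * sin \<kappa> * cos \<psi>" unfolding sin_plus_sin_wedge by simp
  finally have "(t' - t) * (sin (\<kappa> - \<psi>) * sin (\<kappa> + \<psi>)) = \<sigma> * (sin (\<kappa> - \<psi>) * sin (\<kappa> + \<psi>))"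
    using \<sigma> by linarith
  then have "t' = t + \<sigma>" using wedge_sines_pos by simp
  then show ?thesis using t(1) t'(1) by (auto simp: has_chord_def)
qed

text \<open>The wedge chord through the vertex common to the sides offset by \<open>k\<close> and \<open>k + 1\<close>.\<close>
lemma wedge_at_lower_vertex:
  "2 * r * cos \<beta> * sin \<kappa> * cos \<psi> - r * cos (\<kappa> + \<beta> - \<psi>) * sin (2 * \<kappa>)
   = 2 * r * sin \<kappa> * sin (\<kappa> + \<beta>) * sin (\<kappa> - \<psi>)"
proof -
  have "2 * r * cos \<beta> * sin \<kappa> * cos \<psi> - r * cos (\<kappa> + \<beta> - \<psi>) * sin (2 * \<kappa>)
      = 2 * r * sin \<kappa> * (cos \<beta> * cos \<psi> - cos \<kappa> * cos (\<kappa> + \<beta> - \<psi>))"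
    unfolding sin_double by (simp add: algebra_simps)
  then show ?thesis by (simp add: cos_cos_minus_cos_cos)
qed

lemma wedge_at_upper_vertex:
  "2 * r * cos \<beta> * sin \<kappa> * cos \<psi> - r * cos (\<kappa> - \<beta> + \<psi>) * sin (2 * \<kappa>)
   = 2 * r * sin \<kappa> * sin (\<kappa> - \<beta>) * sin (\<kappa> + \<psi>)"
proof -
  have "2 * r * cos \<beta> * sin \<kappa> * cos \<psi> - r * cos (\<kappa> - \<beta> + \<psi>) * sin (2 * \<kappa>)
      = 2 * r * sin \<kappa> * (cos \<beta> * cos \<psi> - cos \<kappa> * cos (\<kappa> - \<beta> + \<psi>))"
    unfolding sin_double by (simp add: algebra_simps)
  then show ?thesis using cos_cos_minus_cos_cos[of "- \<beta>" "- \<psi>" \<kappa>] by simp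
qed

text \<open>The wedge length does not grow with \<open>p\<close>, so its value at the lower vertex
  bounds all chords beyond it. The factor \<open>sin (2 * \<kappa>)\<close> in the first assumption
  lets parallel sides, \<open>\<kappa> = pi / 2\<close>, cover every \<open>p\<close> at
  once.\<close>

lemma chord_le_beyond_lower_vertex:
  assumes "r * cos (\<kappa> + \<beta> - \<psi>) * sin (2 * \<kappa>) \<le> p * sin (2 * \<kappa>)" "2 * r * sin \<kappa> * sin (\<kappa> + \<beta>) \<le> s * sin (\<kappa> + \<psi>)"
    and "has_chord n r \<phi> p \<sigma>"
  shows "\<sigma> \<le> s"
proof -
  have "\<sigma> * (sin (\<kappa> - \<psi>) * sin (\<kappa> + \<psi>)) \<le> 2 * r * sin \<kappa> * sin (\<kappa> + \<beta>) * sin (\<kappa> - \<psi>)"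
    using wedge_chord_le[OF assms(3)] assms(1) wedge_at_lower_vertex by linarith
  also have "\<dots> \<le> s * sin (\<kappa> + \<psi>) * sin (\<kappa> - \<psi>)"
    using assms(2) wedge_sines_pos by (intro mult_right_mono) auto
  finally have "\<sigma> * (sin (\<kappa> - \<psi>) * sin (\<kappa> + \<psi>)) \<le> s * (sin (\<kappa> - \<psi>) * sin (\<kappa> + \<psi>))"
    by (simp add: mult_ac)
  then show ?thesis using wedge_sines_pos by simp
qed

lemma wedge_vertex_le: "r * cos (\<kappa> + \<beta> - \<psi>) \<le> r * cos (\<kappa> - \<beta> + \<psi>)"
  using wedge_angles \<psi> r by (intro mult_left_mono cos_monotone_0_pi_le) auto

lemma upper_end_eq:
  assumes "2 * k < n"
  shows "upper_end n r s k \<psi> * sin (2 * \<kappa>) + s * (sin (\<kappa> - \<psi>) * sin (\<kappa> + \<psi>)) = 2 * r * cos \<beta> * sin \<kappa> * cos \<psi>"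
    and "0 < sin (2 * \<kappa>)"
proof -
  have "real (2 * k) < real n" using assms by (simp only: of_nat_less_iff)
  then have "2 * real k * pi < real n * pi" by simp
  then have "\<kappa> < pi / 2" using n by (simp add: \<kappa> \<beta> field_simps)
  then have c: "0 < cos \<kappa>" using wedge_angles by (intro cos_gt_zero_pi) auto
  then show s2: "0 < sin (2 * \<kappa>)" using wedge_sines_pos by (simp add: sin_double)
  have S: "sin (\<kappa> - \<psi>) * sin (\<kappa> + \<psi>) = (cos \<psi>)\<^sup>2 - (cos \<kappa>)\<^sup>2"
  proof -
    have "sin (\<kappa> - \<psi>) * sin (\<kappa> + \<psi>) = (sin \<kappa>)\<^sup>2 * (cos \<psi>)\<^sup>2 - (cos \<kappa>)\<^sup>2 * (sin \<psi>)\<^sup>2"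
      unfolding sin_diff sin_add by (simp add: power2_eq_square algebra_simps)
    then show ?thesis unfolding sin_squared_eq by (simp add: algebra_simps)
  qed
  have "upper_end n r s k \<psi> = r * cos \<beta> * cos \<psi> / cos \<kappa> - s * (sin (\<kappa> - \<psi>) * sin (\<kappa> + \<psi>)) / sin (2 * \<kappa>)"
    by (simp only: S) (simp only: upper_end_def \<kappa> \<beta>)
  then have "upper_end n r s k \<psi> * sin (2 * \<kappa>)
      = r * cos \<beta> * cos \<psi> / cos \<kappa> * sin (2 * \<kappa>) - s * (sin (\<kappa> - \<psi>) * sin (\<kappa> + \<psi>))"
    using s2 by (simp add: left_diff_distrib)
  also have "r * cos \<beta> * cos \<psi> / cos \<kappa> * sin (2 * \<kappa>) = 2 * r * cos \<beta> * sin \<kappa> * cos \<psi>"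
    using c by (simp add: sin_double)
  finally show "upper_end n r s k \<psi> * sin (2 * \<kappa>) + s * (sin (\<kappa> - \<psi>) * sin (\<kappa> + \<psi>)) = 2 * r * cos \<beta> * sin \<kappa> * cos \<psi>"
    by simp
qed

text \<open>\<open>hi\<close> says that the wedge chord at the lower vertex is longer than
  \<open>s\<close>, \<open>lo\<close> that the one at the upper vertex is not. The wedge length
  decreases affinely in \<open>p\<close>, so it equals \<open>s\<close> between the two vertices,
  where it is the length of a real chord; beyond that offset the wedge bound excludes longer
  chords.\<close>

lemma Sup_long_chords:
  assumes k2: "2 * k < n"
    and lo: "2 * r * sin (\<kappa> - \<beta>) * sin \<kappa> \<le> s * sin (\<kappa> - \<psi>)"
    and hi: "s * sin (\<kappa> + \<psi>) < 2 * r * sin \<kappa> * sin (\<kappa> + \<beta>)"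
  shows "long_chords n r s \<phi> \<noteq> {}" "Sup (long_chords n r s \<phi>) = upper_end n r s k \<psi>"
proof -
  let ?S = "sin (\<kappa> - \<psi>) * sin (\<kappa> + \<psi>)" and ?D = "2 * r * cos \<beta> * sin \<kappa> * cos \<psi>"
  let ?q = "upper_end n r s k \<psi>" and ?b = "r * cos (\<kappa> + \<beta> - \<psi>)"
  note q = upper_end_eq[OF k2]
  have S: "0 < ?S" using wedge_sines_pos by simp
  have upper: "p < ?q" if p: "p \<in> long_chords n r s \<phi>" for p
  proof -
    obtain \<sigma> where "s < \<sigma>" "has_chord n r \<phi> p \<sigma>" using p by (auto simp: long_chords_def)
    then have "s * ?S < \<sigma> * ?S" "\<sigma> * ?S + p * sin (2 * \<kappa>) \<le> ?D"
      using S wedge_chord_le mult_strict_right_mono by blast+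
    then have "p * sin (2 * \<kappa>) < ?q * sin (2 * \<kappa>)" using q(1)[of s] by linarith
    then show ?thesis using q(2) by simp
  qed
  have "?b * sin (2 * \<kappa>) < ?q * sin (2 * \<kappa>)"
  proof -
    have "s * sin (\<kappa> + \<psi>) * sin (\<kappa> - \<psi>) < 2 * r * sin \<kappa> * sin (\<kappa> + \<beta>) * sin (\<kappa> - \<psi>)"
      using hi wedge_sines_pos by (intro mult_strict_right_mono) auto
    moreover have "s * sin (\<kappa> + \<psi>) * sin (\<kappa> - \<psi>) = s * ?S" by simp
    ultimately show ?thesis using wedge_at_lower_vertex q(1)[of s] by linarith
  qed
  then have b: "?b < ?q" using q(2) by simp
  have "?q * sin (2 * \<kappa>) \<le> r * cos (\<kappa> - \<beta> + \<psi>) * sin (2 * \<kappa>)"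
  proof -
    have "2 * r * sin (\<kappa> - \<beta>) * sin \<kappa> * sin (\<kappa> + \<psi>) \<le> s * sin (\<kappa> - \<psi>) * sin (\<kappa> + \<psi>)"
      using lo wedge_sines_pos by (intro mult_right_mono) auto
    moreover have "2 * r * sin (\<kappa> - \<beta>) * sin \<kappa> * sin (\<kappa> + \<psi>) = 2 * r * sin \<kappa> * sin (\<kappa> - \<beta>) * sin (\<kappa> + \<psi>)"
      "s * sin (\<kappa> - \<psi>) * sin (\<kappa> + \<psi>) = s * ?S" by simp_all
    ultimately show ?thesis using wedge_at_upper_vertex q(1)[of s] by linarith
  qed
  then have c: "?q \<le> r * cos (\<kappa> - \<beta> + \<psi>)" using q(2) by simp
  have inner: "p \<in> long_chords n r s \<phi>" if p: "?b \<le> p" "p < ?q" for p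
  proof -
    define \<sigma> where "\<sigma> = (?D - p * sin (2 * \<kappa>)) / ?S"
    have "?S \<noteq> 0" using S by linarith
    then have \<sigma>: "\<sigma> * ?S = ?D - p * sin (2 * \<kappa>)" using nonzero_eq_divide_eq \<sigma>_def by blast
    have "p * sin (2 * \<kappa>) < ?q * sin (2 * \<kappa>)" using p q(2) by simp
    then have "s * ?S < \<sigma> * ?S" using \<sigma> q(1)[of s] by linarith
    then have "s < \<sigma>" using S by (metis less_imp_le mult_right_mono not_less)
    moreover have "has_chord n r \<phi> p \<sigma>" using p c \<sigma> by (intro wedge_chord_exists) auto
    ultimately show ?thesis by (auto simp: long_chords_def)
  qed
  show ne: "long_chords n r s \<phi> \<noteq> {}" using inner[of ?b] b by auto
  show "Sup (long_chords n r s \<phi>) = ?q"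
  proof (rule cSup_eq_non_empty[OF ne])
    show "x \<le> ?q" if "x \<in> long_chords n r s \<phi>" for x using upper[OF that] by simp
    fix y assume y: "\<And>x. x \<in> long_chords n r s \<phi> \<Longrightarrow> x \<le> y"
    show "?q \<le> y"
    proof (rule dense_le_bounded[OF b])
      show "w \<le> y" if "?b < w" "w < ?q" for w using that inner y by simp
    qed
  qed
qed

end

text \<open>A reflection and a rotation carry a cell to the next one in reversed order. The wedge of
  offset \<open>k + 1\<close> is set up in that next cell, and this transfers its results
  back.\<close>

lemma has_chord_swap_cell:
  assumes "0 < n"
  shows "has_chord n r (real (Suc (Suc k)) * (pi / n) + (pi / n - \<psi>)) p \<sigma>
     \<longleftrightarrow> has_chord n r (real (Suc k) * (pi / n) + \<psi>) p \<sigma>"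
proof -
  have "real (Suc (Suc k)) * (pi / n) + (pi / n - \<psi>)
      = - (real (Suc k) * (pi / n) + \<psi>) + 2 * of_int (int k + 2) * (pi / n)"
    by (simp add: algebra_simps add_divide_distrib)
  then show ?thesis by (simp only: has_chord_rot[OF assms] has_chord_reflect[OF assms])
qed

text \<open>For odd \<open>n\<close> the half turn is no symmetry of the polygon. Combined with a
  reflection and a rotation it maps the cell to itself in reversed order, with the sign of
  \<open>p\<close> changed.\<close>

lemma has_chord_opposite_cell:
  assumes "n = 2 * k + 1"
  shows "has_chord n r (real (Suc k) * (pi / n) + (pi / n - \<psi>)) (- p) \<sigma>
     \<longleftrightarrow> has_chord n r (real (Suc k) * (pi / n) + \<psi>) p \<sigma>"
proof -
  have n: "0 < n" using assms by simp
  have "real (Suc k) * (pi / n) + (pi / n - \<psi>)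
      = - (real (Suc k) * (pi / n) + \<psi> + pi) + 2 * of_int (int n + 1) * (pi / n)"
    using n by (simp add: field_simps) (simp add: assms algebra_simps)
  then show ?thesis by (simp only: has_chord_rot[OF n] has_chord_reflect[OF n] has_chord_opposite)
qed

text \<open>No larger offset is left to take over. For even \<open>n\<close> the sides are parallel
  and one wedge bounds all lines. For odd \<open>n\<close> the lines before the vertex become, seen
  from the opposite direction, lines beyond the vertex at the mirrored position
  \<open>\<beta> - \<psi>\<close>, and the assumption on \<open>s\<close> is invariant under this
  mirroring.\<close>

lemma long_chords_empty:
  assumes n: "3 \<le> n" and r: "0 < r" and k: "k = n div 2"
    and \<beta>: "\<beta> = pi / n" and \<kappa>: "\<kappa> = real k * \<beta>" and \<psi>: "0 < \<psi>" "\<psi> < \<beta>"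
    and s: "2 * r * sin \<kappa> * sin (\<kappa> + \<beta>) \<le> s * sin (\<kappa> + \<psi>)"
  shows "long_chords n r s (real (Suc k) * \<beta> + \<psi>) = {}"
proof -
  have k': "1 \<le> k" "2 * k \<le> n" using n k by auto
  have npos: "0 < real n" using n by simp
  have "\<sigma> \<le> s" if c: "has_chord n r (real (Suc k) * \<beta> + \<psi>) p \<sigma>" for p \<sigma>
  proof (cases "even n")
    case True
    then have "real n = 2 * real k" using k by auto
    then have "2 * \<kappa> = pi" using npos by (simp add: \<kappa> \<beta>)
    then have "sin (2 * \<kappa>) = 0" by (simp only: sin_pi)
    then show ?thesis
      by (intro chord_le_beyond_lower_vertex[OF n r k' \<beta> \<kappa> refl \<psi> _ s c]) simp
  next
    case False
    then have nk: "n = 2 * k + 1" using k by (simp add: odd_two_times_div_two_succ)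
    have "(2 * real k + 1) * \<beta> = real n * \<beta>" by (simp add: nk)
    also have "\<dots> = pi" using npos by (simp add: \<beta>)
    finally have sum: "2 * \<kappa> + \<beta> = pi" by (simp add: \<kappa> algebra_simps)
    have "0 < \<beta>" using \<psi> by simp
    have s2: "0 \<le> sin (2 * \<kappa>)" using sum \<open>0 < \<beta>\<close> k' by (intro sin_ge_zero) (auto simp: \<kappa>)
    let ?b = "r * cos (\<kappa> + \<beta> - \<psi>)"
    show ?thesis
    proof (cases "?b \<le> p")
      case True
      then show ?thesis
        using s2 by (intro chord_le_beyond_lower_vertex[OF n r k' \<beta> \<kappa> refl \<psi> _ s c] mult_right_mono)
    next
      case False
      have "\<kappa> + \<beta> - (\<beta> - \<psi>) = pi - (\<kappa> + \<beta> - \<psi>)" using sum by simp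
      then have "r * cos (\<kappa> + \<beta> - (\<beta> - \<psi>)) = - ?b" by (simp only: cos_pi_minus mult_minus_right)
      then have p: "r * cos (\<kappa> + \<beta> - (\<beta> - \<psi>)) * sin (2 * \<kappa>) \<le> - p * sin (2 * \<kappa>)"
        using False s2 by (intro mult_right_mono) auto
      have "\<kappa> + (\<beta> - \<psi>) = pi - (\<kappa> + \<psi>)" using sum by simp
      then have "sin (\<kappa> + (\<beta> - \<psi>)) = sin (\<kappa> + \<psi>)" by (simp only: sin_pi_minus)
      with s have s': "2 * r * sin \<kappa> * sin (\<kappa> + \<beta>) \<le> s * sin (\<kappa> + (\<beta> - \<psi>))" by simp
      have "has_chord n r (real (Suc k) * \<beta> + (\<beta> - \<psi>)) (- p) \<sigma>"
        using c has_chord_opposite_cell[OF nk] unfolding \<beta> by simp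
      then show ?thesis
        using \<psi> by (intro chord_le_beyond_lower_vertex[OF n r k' \<beta> \<kappa> refl _ _ p s']) auto
    qed
  qed
  then show ?thesis by (force simp: long_chords_def)
qed

section \<open>The measure of all meeting lines and the reduction to one cell\<close>

lemma Sup_meeting_lines:
  assumes n: "3 \<le> n" and r: "0 < r" and \<psi>: "0 < \<psi>" "\<psi> < pi / n"
  shows "Sup {p. has_chord n r (real (Suc 1) * (pi / n) + \<psi>) p 0} = r * cos \<psi>"
    and "{p. has_chord n r (real (Suc 1) * (pi / n) + \<psi>) p 0} \<noteq> {}"
proof -
  let ?\<beta> = "pi / real n" and ?\<phi> = "real (Suc 1) * (pi / n) + \<psi>"
  \<comment> \<open>Offset 1 with chord length 0: the two sides share the vertex at angle
    \<open>2 * ?\<beta>\<close>, whose projection \<open>r * cos \<psi>\<close> is the support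
    function of the polygon.\<close>
  have k: "1 \<le> (1::nat)" "2 * 1 \<le> n" using n by auto
  have \<kappa>: "?\<beta> = real 1 * ?\<beta>" by simp
  note wedge = n r k refl \<kappa> refl \<psi>
  have pos: "sin (2 * ?\<beta>) > 0" using n by (intro upper_end_eq(2)[OF wedge]) auto
  have *: "2 * r * cos ?\<beta> * sin ?\<beta> * cos \<psi> = r * cos \<psi> * sin (2 * ?\<beta>)"
    unfolding sin_double by simp
  have "p \<le> r * cos \<psi>" if "has_chord n r ?\<phi> p 0" for p
  proof -
    have "p * sin (2 * ?\<beta>) \<le> r * cos \<psi> * sin (2 * ?\<beta>)"
      using wedge_chord_le[OF wedge that] unfolding * by simp
    then show ?thesis using pos by (rule mult_right_le_imp_le)
  qed
  moreover have "has_chord n r ?\<phi> (r * cos \<psi>) 0"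
    using wedge_vertex_le[OF wedge] * by (intro wedge_chord_exists[OF wedge]) auto
  ultimately show "Sup {p. has_chord n r ?\<phi> p 0} = r * cos \<psi>" "{p. has_chord n r ?\<phi> p 0} \<noteq> {}"
    by (auto intro!: cSup_eq_maximum)
qed

lemma measure_meeting_lines:
  assumes n: "3 \<le> n" and r: "0 < r"
  defines "A \<equiv> {(p, \<phi>). 0 \<le> p \<and> 0 \<le> \<phi> \<and> \<phi> < 2 * pi \<and> has_chord n r \<phi> p 0}"
  shows "A \<in> sets lborel" "emeasure lborel A = ennreal (perimeter n r)" "0 \<le> perimeter n r"
proof -
  define X where "X \<phi> = {p. has_chord n r \<phi> p 0}" for \<phi>
  have npos: "0 < n" using n by simp
  have g: "((\<lambda>\<psi>. r * cos \<psi>) has_integral r * sin (pi / n)) {0..pi / n}"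
  proof -
    have "((\<lambda>\<psi>. r * cos \<psi>) has_integral r * sin (pi / n) - r * sin 0) {0..pi / n}"
      by (rule fundamental_theorem_of_calculus)
         (auto intro!: derivative_eq_intros simp flip: has_real_derivative_iff_has_vector_derivative)
    then show ?thesis by simp
  qed
  have meas: "{(p, \<phi>). p \<in> X \<phi>} \<in> sets borel"
    using borel_closed[OF closed_has_chord[of r n 0]] r by (simp add: X_def)
  have rot: "X (\<phi> + 2 * (pi / n)) = X \<phi>" for \<phi>
    using has_chord_rot[OF npos, of r \<phi> 1] by (simp add: X_def)
  have opp: "X (\<phi> + pi) = uminus ` X \<phi>" for \<phi>
    using has_chord_opposite[of n r \<phi>] by (force simp: X_def image_iff intro: exI[of _ "- _"])
  note * = emeasure_symmetric_line_set[OF npos meas, where R = r and N = "{}" and j = "Suc 1", OF _ _ rot _ opp g]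
  have iv: "is_interval (X \<phi>)" for \<phi> by (simp add: X_def is_interval_meeting_lines)
  have bd: "X \<phi> \<subseteq> {-r..r}" for \<phi> using has_chord_bound r by (auto simp: X_def)
  have refl: "X (- \<phi>) = X \<phi>" for \<phi> by (simp add: X_def has_chord_reflect[OF npos])
  have gX: "r * cos \<psi> = (if X (real (Suc 1) * (pi / n) + \<psi>) = {} then 0 else Sup (X (real (Suc 1) * (pi / n) + \<psi>)))"
    if "0 < \<psi>" "\<psi> < pi / n" for \<psi>
    using Sup_meeting_lines[OF n r that] unfolding X_def by (simp only: if_False simp_thms)
  have A: "A = {(p, \<phi>). 0 \<le> p \<and> 0 \<le> \<phi> \<and> \<phi> < 2 * pi \<and> p \<in> X \<phi>}" by (simp add: A_def X_def)
  have P: "perimeter n r = 2 * real n * (r * sin (pi / n))" by (simp add: perimeter_def)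
  show "A \<in> sets lborel" "emeasure lborel A = ennreal (perimeter n r)" "0 \<le> perimeter n r"
    unfolding A P by (rule *[OF iv bd refl]; use gX in simp)+
qed

text \<open>The counted lines are the meeting lines minus the long chords; the factor
  \<open>2 * real n\<close> cancels against the perimeter. The cell \<open>j\<close> is free and is
  chosen to suit the offset.\<close>

lemma chord_F_eq:
  assumes n: "3 \<le> n" and r: "0 < r" and s: "0 \<le> s"
    and g: "(g has_integral I) {0..pi / n}" and fin: "finite N"
    and gX: "\<And>\<psi>. 0 < \<psi> \<Longrightarrow> \<psi> < pi / n \<Longrightarrow> \<psi> \<notin> N \<Longrightarrow>
               g \<psi> = (if long_chords n r s (real j * (pi / n) + \<psi>) = {} then 0
                       else Sup (long_chords n r s (real j * (pi / n) + \<psi>)))"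
  shows "chord_F n r s = 1 - I / (r * sin (pi / n))"
proof -
  let ?A = "{(p, \<phi>). 0 \<le> p \<and> 0 \<le> \<phi> \<and> \<phi> < 2 * pi \<and> has_chord n r \<phi> p 0}"
  let ?B = "{(p, \<phi>). 0 \<le> p \<and> 0 \<le> \<phi> \<and> \<phi> < 2 * pi \<and> p \<in> long_chords n r s \<phi>}"
  have npos: "0 < n" using n by simp
  have rot: "long_chords n r s (\<phi> + 2 * (pi / n)) = long_chords n r s \<phi>" for \<phi>
    using has_chord_rot[OF npos, of r \<phi> 1] by (simp add: long_chords_def)
  have opp: "long_chords n r s (\<phi> + pi) = uminus ` long_chords n r s \<phi>" for \<phi>
    using has_chord_opposite[of n r \<phi>] by (force simp: long_chords_def image_iff intro: exI[of _ "- _"])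
  have bd: "long_chords n r s \<phi> \<subseteq> {-r..r}" for \<phi> using has_chord_bound r by (auto simp: long_chords_def)
  have refl: "long_chords n r s (- \<phi>) = long_chords n r s \<phi>" for \<phi>
    by (simp add: long_chords_def has_chord_reflect[OF npos])
  note B = emeasure_symmetric_line_set[OF npos borel_long_chords[OF less_imp_le[OF r] s]
      is_interval_long_chords bd rot refl opp g fin gX]
  note A = measure_meeting_lines[OF n r]
  have "{(p, \<phi>). 0 \<le> p \<and> 0 \<le> \<phi> \<and> \<phi> < 2 * pi \<and> line_pphi p \<phi> \<inter> reg_polygon n r \<noteq> {} \<and>
        diameter (line_pphi p \<phi> \<inter> reg_polygon n r) \<le> s} = ?A - ?B"
    by (auto simp: line_meets_iff diameter_chord_le_iff[OF s])
  moreover have "?B \<subseteq> ?A"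
    using has_chord_mono[where \<sigma>' = 0] s by (fastforce simp: long_chords_def)
  then have "measure lborel (?A - ?B) = measure lborel ?A - measure lborel ?B"
    using A B by (intro measure_Diff) auto
  moreover have "measure lborel ?A = perimeter n r" "measure lborel ?B = 2 * real n * I"
    using A B by (simp_all add: measure_def)
  moreover have "0 < sin (pi / n)" using n by (intro sin_gt_zero) (auto simp: field_simps)
  ultimately show ?thesis using npos r by (simp add: chord_F_def perimeter_def field_simps)
qed

subsection \<open>The primitive of the upper end\<close>

text \<open>The odd primitive of \<open>upper_end\<close>: vanishing at 0 removes the boundary terms
  at the cell ends, and oddness accounts for the differing signs in the final formula.\<close>

definition upper_end_prim :: "nat \<Rightarrow> real \<Rightarrow> real \<Rightarrow> nat \<Rightarrow> real \<Rightarrow> real" where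
  "upper_end_prim n r s k \<psi> = r * cos (pi / n) * sin \<psi> / cos (real k * (pi / n))
     - s * (sin (2 * \<psi>) / 4 - \<psi> * cos (2 * (real k * (pi / n))) / 2) / sin (2 * (real k * (pi / n)))"

lemma upper_end_prim_minus: "upper_end_prim n r s k (- \<psi>) = - upper_end_prim n r s k \<psi>"
  by (simp add: upper_end_prim_def minus_divide_left[symmetric] diff_divide_distrib algebra_simps)

lemma upper_end_prim_0: "upper_end_prim n r s k 0 = 0"
  by (simp add: upper_end_prim_def)

lemma upper_end_has_integral:
  assumes "a \<le> b"
  shows "(upper_end n r s k has_integral upper_end_prim n r s k b - upper_end_prim n r s k a) {a..b}"
proof (rule fundamental_theorem_of_calculus[OF assms])
  fix x
  let ?\<kappa> = "real k * (pi / n)"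
  have "(upper_end_prim n r s k has_real_derivative
      r * cos (pi / n) * cos x / cos ?\<kappa> - s * (cos (2 * x) * 2 / 4 - cos (2 * ?\<kappa>) / 2) / sin (2 * ?\<kappa>)) (at x within {a..b})"
    unfolding upper_end_prim_def
    by (intro DERIV_diff DERIV_cdivide DERIV_cmult) (auto intro!: derivative_eq_intros)
  moreover have "cos (2 * x) * 2 / 4 - cos (2 * ?\<kappa>) / 2 = (cos x)\<^sup>2 - (cos ?\<kappa>)\<^sup>2"
    unfolding cos_double_cos by (simp add: field_simps)
  ultimately show "(upper_end_prim n r s k has_vector_derivative upper_end n r s k x) (at x within {a..b})"
    unfolding upper_end_def has_real_derivative_iff_has_vector_derivative[symmetric] by simp
qed

text \<open>For \<open>\<alpha> = arcsin (a / s)\<close> the sine is \<open>a / s\<close> and the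
  cosine is \<open>sqrt (s\<^sup>2 - a\<^sup>2) / s\<close>. Expanding
  \<open>sin (b - \<alpha>)\<close> and \<open>sin (2 * (b - \<alpha>))\<close> and sorting by the
  four functions of \<open>s\<close> yields the four coefficients.\<close>

lemma hk_eq_upper_end_prim:
  assumes k: "k \<noteq> 0" and r: "r \<noteq> 0" and s: "0 < s" and a: "0 \<le> a" "a \<le> s"
  shows "hk n r k s a b = - upper_end_prim n r s k (b - arcsin (a / s)) / (r * sin (pi / n))"
proof -
  define \<alpha> where "\<alpha> = arcsin (a / s)"
  define A where "A = a / s"
  define c where "c = sqrt (s\<^sup>2 - a\<^sup>2) / s"
  define \<kappa>2 where "\<kappa>2 = 2 * real k * pi / n"
  have aA: "a = s * A" using s by (simp add: A_def)
  have A1: "A \<le> 1" "0 \<le> A" using a s by (simp_all add: A_def)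
  have sa: "sin \<alpha> = A" using A1 by (simp add: \<alpha>_def A_def)
  have "cos \<alpha> = sqrt (1 - A\<^sup>2)" using A1 cos_arcsin[of A] by (simp add: \<alpha>_def A_def)
  also have "\<dots> = sqrt ((s\<^sup>2 - a\<^sup>2) / s\<^sup>2)" using s by (simp add: aA power_mult_distrib diff_divide_distrib)
  also have "\<dots> = c" using s by (simp add: c_def real_sqrt_divide)
  finally have ca: "cos \<alpha> = c" .
  have s1: "sin (b - \<alpha>) = sin b * c - cos b * A" by (simp add: sin_diff sa ca)
  have c2: "cos (2 * \<alpha>) = 1 - 2 * A\<^sup>2" by (simp add: cos_double_sin sa)
  have "sin (2 * (b - \<alpha>)) = sin (2 * b - 2 * \<alpha>)" by (simp add: algebra_simps)
  also have "\<dots> = sin (2 * b) * (1 - 2 * A\<^sup>2) - cos (2 * b) * (2 * A * c)"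
    unfolding sin_diff c2 by (simp add: sin_double[of \<alpha>] sa ca)
  finally have s2: "sin (2 * (b - \<alpha>)) = sin (2 * b) * (1 - 2 * A\<^sup>2) - cos (2 * b) * (2 * A * c)" .
  have k2: "2 * (real k * (pi / n)) = \<kappa>2" by (simp add: \<kappa>2_def)
  define C where "C = cos (pi / n) / sin (pi / n)"
  define E where "E = 1 / cos (real k * (pi / n))"
  define D where "D = 1 / (r * sin (pi / n))"
  define U where "U = 1 / sin \<kappa>2"
  define V where "V = cos \<kappa>2 / sin \<kappa>2"
  have CD: "r * cos (pi / n) * D = C" using r by (simp add: C_def D_def)
  have prim: "- upper_end_prim n r s k (b - \<alpha>) / (r * sin (pi / n))
      = - (C * E * sin (b - \<alpha>)) + s * D * (sin (2 * (b - \<alpha>)) / 4 * U - (b - \<alpha>) * V / 2)"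
  proof -
    have "upper_end_prim n r s k (b - \<alpha>) = r * cos (pi / n) * E * sin (b - \<alpha>)
        - s * (sin (2 * (b - \<alpha>)) / 4 * U - (b - \<alpha>) * V / 2)"
      unfolding upper_end_prim_def k2 by (simp add: E_def U_def V_def right_diff_distrib diff_divide_distrib)
    then have "- upper_end_prim n r s k (b - \<alpha>) / (r * sin (pi / n)) = - (r * cos (pi / n) * D * E * sin (b - \<alpha>))
        + s * D * (sin (2 * (b - \<alpha>)) / 4 * U - (b - \<alpha>) * V / 2)"
      by (simp add: D_def diff_divide_distrib)
    then show ?thesis unfolding CD .
  qed
  have T: "Theta1 n r k a b = D / 4 * (sin (2 * b) * U - 2 * b * V)"
    "Theta2 n r k a b = a * (cos b * C * E - a * D / 2 * sin (2 * b) * U)"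
    "Theta3 n r k a b = - (sin b * C * E + a * D / 2 * cos (2 * b) * U)"
    "Theta4 n r k a b = D / 2 * V"
    by (simp_all add: Theta1_def Theta2_def Theta3_def Theta4_def csc_def sec_def cot_def
        C_def D_def E_def U_def V_def \<kappa>2_def)
  have as: "a * (x * (1 / s)) = A * x" for x using s by (simp add: aA)
  have "hk n r k s a b = D / 4 * (sin (2 * b) * U - 2 * b * V) * s
      + a * ((cos b * C * E - a * D / 2 * sin (2 * b) * U) * (1 / s))
      + - (sin b * C * E + a * D / 2 * cos (2 * b) * U) * c + D / 2 * V * (s * \<alpha>)"
    using k by (simp add: hk_def T \<alpha>_def) (simp add: c_def)
  also have "\<dots> = D / 4 * (sin (2 * b) * U - 2 * b * V) * s
      + A * (cos b * C * E - s * A * D / 2 * sin (2 * b) * U)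
      + - (sin b * C * E + s * A * D / 2 * cos (2 * b) * U) * c + D / 2 * V * (s * \<alpha>)"
    unfolding as by (simp only: aA)
  also have "\<dots> = - (C * E * sin (b - \<alpha>)) + s * D * (sin (2 * (b - \<alpha>)) / 4 * U - (b - \<alpha>) * V / 2)"
    unfolding s1 s2 by (simp add: field_simps power2_eq_square)
  finally show ?thesis using prim by (simp only: \<alpha>_def)
qed

lemma has_integral_if_less:
  fixes f g :: "real \<Rightarrow> real"
  assumes "a \<le> c" "c \<le> b" "(f has_integral I) {a..c}" "(g has_integral J) {c..b}"
  shows "((\<lambda>x. if x < c then f x else g x) has_integral I + J) {a..b}"
proof (rule has_integral_combine[OF assms(1,2)])
  show "((\<lambda>x. if x < c then f x else g x) has_integral I) {a..c}"
    by (rule has_integral_spike_finite[of "{c}", OF _ _ assms(3)]) auto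
  show "((\<lambda>x. if x < c then f x else g x) has_integral J) {c..b}"
    by (rule has_integral_spike_finite[of "{}", OF _ _ assms(4)]) auto
qed

text \<open>The chord through the vertex separating two consecutive side offsets grows with the offset.\<close>
lemma vertex_chord_mono:
  fixes \<kappa> \<beta> \<psi> :: real
  assumes "0 \<le> sin (2 * \<kappa> + 2 * \<beta>)" "0 \<le> sin \<psi>"
  shows "sin \<kappa> * sin (\<kappa> + 2 * \<beta> - \<psi>) \<le> sin (\<kappa> + 2 * \<beta>) * sin (\<kappa> + \<psi>)"
proof -
  let ?x = "2 * \<kappa> + 2 * \<beta>"
  have "sin (\<kappa> + 2 * \<beta>) * sin (\<kappa> + \<psi>) - sin \<kappa> * sin (\<kappa> + 2 * \<beta> - \<psi>)
      = (cos (?x - \<psi>) - cos (?x + \<psi>)) / 2"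
  proof -
    have "cos (\<kappa> - (\<kappa> + 2 * \<beta> - \<psi>)) = cos (\<kappa> + 2 * \<beta> - (\<kappa> + \<psi>))"
      using cos_minus[of "2 * \<beta> - \<psi>"] by simp
    then show ?thesis unfolding sin_times_sin
      by (simp add: algebra_simps add_divide_distrib diff_divide_distrib)
  qed
  also have "\<dots> = sin ?x * sin \<psi>" unfolding cos_add[of ?x] cos_diff[of ?x] by simp
  finally show ?thesis using mult_nonneg_nonneg[OF assms] by linarith
qed

subsection \<open>Integration over one angular cell\<close>

lemma upper_end_reflect_has_integral:
  fixes a b c :: real
  assumes "a \<le> b"
  shows "((\<lambda>\<psi>. upper_end n r s k (c - \<psi>)) has_integral
           upper_end_prim n r s k (c - a) - upper_end_prim n r s k (c - b)) {a..b}"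
proof -
  have "c - b \<le> c - a" using assms by simp
  from has_integral_reflect_about[OF upper_end_has_integral[OF this], where c = c] show ?thesis by simp
qed

context
  fixes n k :: nat and r s \<beta> \<kappa> \<alpha> :: real
  assumes n: "3 \<le> n" and r: "0 < r" and \<beta>: "\<beta> = pi / n" and \<kappa>: "\<kappa> = real k * \<beta>"
    and k: "k + 1 \<le> n div 2"
    and s: "ell n r k \<le> s" "s < ell n r (k + 1)" "0 < s"
    and \<alpha>: "\<alpha> = arcsin (A1 n r k / s)"
begin

lemma cell_angles: "0 < \<beta>" "0 \<le> \<kappa>" "\<kappa> + \<beta> \<le> pi / 2" "\<kappa> + \<beta> = real (Suc k) * \<beta>" "real n * \<beta> = pi"
  "0 < sin \<beta>"
proof -
  have npos: "0 < real n" using n by simp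
  show b: "0 < \<beta>" using npos by (simp add: \<beta>)
  show "0 \<le> \<kappa>" using b by (simp add: \<kappa>)
  show "\<kappa> + \<beta> = real (Suc k) * \<beta>" by (simp add: \<kappa> algebra_simps)
  show nb: "real n * \<beta> = pi" using npos by (simp add: \<beta>)
  have "2 * (k + 1) \<le> n" using k by simp
  then have "real (2 * (k + 1)) \<le> real n" by (simp only: of_nat_le_iff)
  then have "real (2 * (k + 1)) * \<beta> \<le> real n * \<beta>" using b by (intro mult_right_mono) auto
  then show kb: "\<kappa> + \<beta> \<le> pi / 2" unfolding nb by (simp add: \<kappa> algebra_simps)
  show "0 < sin \<beta>" using b kb \<open>0 \<le> \<kappa>\<close> pi_gt_zero by (intro sin_gt_zero) auto
qed

lemma ell_A1_eq:
  "ell n r k = 2 * r * sin \<kappa>" "ell n r (k + 1) = 2 * r * sin (\<kappa> + \<beta>)"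
  "A1 n r k = 2 * r * sin \<kappa> * sin (\<kappa> + \<beta>)" "B1 n k = \<kappa>"
proof -
  have "real k * pi / n = \<kappa>" "real (k + 1) * pi / n = \<kappa> + \<beta>"
    by (simp_all add: \<kappa> \<beta> algebra_simps add_divide_distrib)
  then show "ell n r k = 2 * r * sin \<kappa>" "ell n r (k + 1) = 2 * r * sin (\<kappa> + \<beta>)"
    "A1 n r k = 2 * r * sin \<kappa> * sin (\<kappa> + \<beta>)" "B1 n k = \<kappa>"
    by (simp_all only: ell_def A1_def B1_def)
qed

lemma A1_bounds: "0 \<le> A1 n r k" "A1 n r k \<le> s"
proof -
  have pos: "0 \<le> sin \<kappa>" "0 \<le> sin (\<kappa> + \<beta>)"
    using cell_angles pi_gt_zero by (auto intro!: sin_ge_zero)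
  then show "0 \<le> A1 n r k" using r by (simp add: ell_A1_eq)
  have "2 * r * sin \<kappa> * sin (\<kappa> + \<beta>) \<le> 2 * r * sin \<kappa> * 1"
    using pos r by (intro mult_left_mono) auto
  then show "A1 n r k \<le> s" using s(1) by (simp add: ell_A1_eq)
qed

lemma sin_alpha: "s * sin \<alpha> = A1 n r k"
proof -
  have "0 \<le> A1 n r k / s" "A1 n r k / s \<le> 1" using A1_bounds s(3) by auto
  then have "sin \<alpha> = A1 n r k / s" unfolding \<alpha> by (intro sin_arcsin) auto
  then show ?thesis using s(3) by simp
qed

text \<open>\<open>A1 n r k\<close> equals both \<open>ell n r k * sin (\<kappa> + \<beta>)\<close>
  and \<open>ell n r (k + 1) * sin \<kappa>\<close>. The range of \<open>s\<close> thus puts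
  \<open>A1 n r k / s\<close> between \<open>sin \<kappa>\<close> and
  \<open>sin (\<kappa> + \<beta>)\<close>, and the change of offset at
  \<open>\<alpha> - \<kappa>\<close> into the cell.\<close>

lemma alpha_bounds: "\<kappa> \<le> \<alpha>" "\<alpha> \<le> \<kappa> + \<beta>" "\<alpha> \<le> pi / 2" "k = 0 \<Longrightarrow> \<alpha> = \<kappa>"
proof -
  have pos: "0 \<le> sin \<kappa>" "0 \<le> sin (\<kappa> + \<beta>)"
    using cell_angles pi_gt_zero by (auto intro!: sin_ge_zero)
  have A: "0 \<le> A1 n r k / s" "A1 n r k / s \<le> 1" using A1_bounds s by auto
  have "s * sin \<kappa> \<le> 2 * r * sin (\<kappa> + \<beta>) * sin \<kappa>"
    using s(2)[unfolded ell_A1_eq(2)] pos by (intro mult_right_mono) auto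
  then have "sin \<kappa> \<le> A1 n r k / s" using s(3) by (simp add: ell_A1_eq field_simps)
  then show "\<kappa> \<le> \<alpha>" unfolding \<alpha> using cell_angles A by (subst le_arcsin_iff) auto
  have "2 * r * sin \<kappa> * sin (\<kappa> + \<beta>) \<le> s * sin (\<kappa> + \<beta>)"
    using s(1) pos by (intro mult_right_mono) (auto simp: ell_A1_eq)
  then have "A1 n r k / s \<le> sin (\<kappa> + \<beta>)" using s(3) by (simp add: ell_A1_eq field_simps)
  then show "\<alpha> \<le> \<kappa> + \<beta>" unfolding \<alpha> using cell_angles A by (subst arcsin_le_iff) auto
  show "\<alpha> \<le> pi / 2" unfolding \<alpha> using A by (intro arcsin_ubound) auto
  show "\<alpha> = \<kappa>" if "k = 0"
  proof -
    have "\<kappa> = 0" using that by (simp add: \<kappa>)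
    then show ?thesis using ell_A1_eq(3) by (simp add: \<alpha>)
  qed
qed

lemma Sup_long_chords_first:
  assumes \<psi>: "0 < \<psi>" "\<psi> < \<beta>" "\<psi> < \<alpha> - \<kappa>"
  shows "long_chords n r s (real (Suc k) * \<beta> + \<psi>) \<noteq> {}"
    "Sup (long_chords n r s (real (Suc k) * \<beta> + \<psi>)) = upper_end n r s k \<psi>"
proof -
  \<comment> \<open>For \<open>k = 0\<close> the assumed range of \<open>\<psi>\<close> is empty, in
    accordance with the value 0 of \<open>hk\<close>.\<close>
  have "k \<noteq> 0" using alpha_bounds(4) \<psi> by auto
  then have k1: "1 \<le> k" "2 * k \<le> n" "2 * k < n" using k by auto
  have kb: "\<beta> \<le> \<kappa>" using k1 cell_angles by (simp add: \<kappa>)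
  have lo: "2 * r * sin (\<kappa> - \<beta>) * sin \<kappa> \<le> s * sin (\<kappa> - \<psi>)"
  proof -
    have "2 * r * sin \<kappa> * sin (\<kappa> - \<beta>) \<le> s * sin (\<kappa> - \<psi>)"
    proof (intro mult_mono)
      show "2 * r * sin \<kappa> \<le> s" using s(1) by (simp add: ell_A1_eq)
      show "sin (\<kappa> - \<beta>) \<le> sin (\<kappa> - \<psi>)"
        using kb cell_angles \<psi> by (intro sin_monotone_2pi_le) auto
      show "0 \<le> sin (\<kappa> - \<beta>)" using kb cell_angles pi_gt_zero by (intro sin_ge_zero) auto
    qed (use s in simp)
    then show ?thesis by (simp add: mult_ac)
  qed
  have "sin (\<kappa> + \<psi>) < sin \<alpha>"
    using \<psi> cell_angles alpha_bounds by (intro sin_monotone_2pi) auto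
  then have "s * sin (\<kappa> + \<psi>) < s * sin \<alpha>" using s(3) by simp
  then have hi: "s * sin (\<kappa> + \<psi>) < 2 * r * sin \<kappa> * sin (\<kappa> + \<beta>)" unfolding sin_alpha ell_A1_eq .
  note * = Sup_long_chords[OF n r k1(1,2) \<beta> \<kappa> refl \<psi>(1,2) k1(3) lo hi]
  show "long_chords n r s (real (Suc k) * \<beta> + \<psi>) \<noteq> {}"
    "Sup (long_chords n r s (real (Suc k) * \<beta> + \<psi>)) = upper_end n r s k \<psi>" by (rule *)+
qed

lemma long_chords_swap: "long_chords n r s (real (Suc k) * \<beta> + \<psi>) = long_chords n r s (real (Suc (Suc k)) * \<beta> + (\<beta> - \<psi>))"
  using has_chord_swap_cell[of n r k \<psi>] n unfolding \<beta> long_chords_def by simp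

text \<open>The failure of \<open>hi\<close> in \<open>Sup_long_chords\<close> for offset
  \<open>k\<close> is, after replacing \<open>\<kappa>\<close> by \<open>\<kappa> + \<beta>\<close>
  and \<open>\<psi>\<close> by \<open>\<beta> - \<psi>\<close>, the condition \<open>lo\<close> for
  offset \<open>k + 1\<close>: no direction is left between the two offsets.\<close>

lemma A1_le_second:
  assumes "\<psi> < \<beta>" "\<alpha> - \<kappa> \<le> \<psi>"
  shows "2 * r * sin \<kappa> * sin (\<kappa> + \<beta>) \<le> s * sin (\<kappa> + \<psi>)"
proof -
  have "0 \<le> \<alpha>" using alpha_bounds cell_angles by linarith
  then have "sin \<alpha> \<le> sin (\<kappa> + \<psi>)"
    using assms cell_angles alpha_bounds pi_gt_zero by (intro sin_monotone_2pi_le) auto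
  then have "s * sin \<alpha> \<le> s * sin (\<kappa> + \<psi>)" using s(3) by simp
  then show ?thesis unfolding sin_alpha ell_A1_eq .
qed

lemma Sup_long_chords_second:
  assumes \<psi>: "0 < \<psi>" "\<psi> < \<beta>" "\<alpha> - \<kappa> \<le> \<psi>" and k2: "2 * (k + 1) < n"
    and hi: "s * sin (\<kappa> + 2 * \<beta> - \<psi>) < 2 * r * sin (\<kappa> + \<beta>) * sin (\<kappa> + 2 * \<beta>)"
  shows "long_chords n r s (real (Suc k) * \<beta> + \<psi>) \<noteq> {}"
    "Sup (long_chords n r s (real (Suc k) * \<beta> + \<psi>)) = upper_end n r s (k + 1) (\<beta> - \<psi>)"
proof -
  have k1: "1 \<le> Suc k" "2 * Suc k \<le> n" "2 * Suc k < n" using k2 by auto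
  have \<psi>': "0 < \<beta> - \<psi>" "\<beta> - \<psi> < \<beta>" using \<psi> by auto
  have eq: "\<kappa> + \<beta> - \<beta> = \<kappa>" "\<kappa> + \<beta> - (\<beta> - \<psi>) = \<kappa> + \<psi>" "\<kappa> + \<beta> + (\<beta> - \<psi>) = \<kappa> + 2 * \<beta> - \<psi>"
    "\<kappa> + \<beta> + \<beta> = \<kappa> + 2 * \<beta>" by simp_all
  note * = Sup_long_chords[OF n r k1(1,2) \<beta> cell_angles(4) refl \<psi>' k1(3), unfolded eq,
      OF A1_le_second[OF \<psi>(2,3)] hi]
  show "long_chords n r s (real (Suc k) * \<beta> + \<psi>) \<noteq> {}"
    "Sup (long_chords n r s (real (Suc k) * \<beta> + \<psi>)) = upper_end n r s (k + 1) (\<beta> - \<psi>)"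
    unfolding long_chords_swap Suc_eq_plus1[symmetric] by (rule *)+
qed

lemma long_chords_empty_second:
  assumes \<psi>: "0 < \<psi>" "\<psi> < \<beta>" and k2: "k + 1 = n div 2"
    and hi: "2 * r * sin (\<kappa> + \<beta>) * sin (\<kappa> + 2 * \<beta>) \<le> s * sin (\<kappa> + 2 * \<beta> - \<psi>)"
  shows "long_chords n r s (real (Suc k) * \<beta> + \<psi>) = {}"
proof -
  have k1: "Suc k = n div 2" using k2 by simp
  have \<psi>': "0 < \<beta> - \<psi>" "\<beta> - \<psi> < \<beta>" using \<psi> by auto
  have eq: "\<kappa> + \<beta> + (\<beta> - \<psi>) = \<kappa> + 2 * \<beta> - \<psi>" "\<kappa> + \<beta> + \<beta> = \<kappa> + 2 * \<beta>" by simp_all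
  show ?thesis unfolding long_chords_swap
    by (rule long_chords_empty[OF n r k1 \<beta> cell_angles(4) \<psi>', unfolded eq, OF hi])
qed

lemma hk_first: "hk n r k s (A1 n r k) (B1 n k) = upper_end_prim n r s k (\<alpha> - \<kappa>) / (r * sin \<beta>)"
proof (cases "k = 0")
  case True
  then show ?thesis using alpha_bounds(4) by (simp add: hk_def upper_end_prim_0)
next
  case False
  have "hk n r k s (A1 n r k) (B1 n k) = - upper_end_prim n r s k (\<kappa> - \<alpha>) / (r * sin \<beta>)"
    using hk_eq_upper_end_prim[OF False _ s(3) A1_bounds] r by (simp add: ell_A1_eq(4) \<alpha> \<beta>)
  then show ?thesis using upper_end_prim_minus[of n r s k "\<alpha> - \<kappa>"] by simp
qed

lemma hk_second: "hk n r (k + 1) s (A1 n r k) (B1 n k + pi / n) = - upper_end_prim n r s (k + 1) (\<kappa> + \<beta> - \<alpha>) / (r * sin \<beta>)"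
  using hk_eq_upper_end_prim[OF _ _ s(3) A1_bounds, of "k + 1" r n] r by (simp add: ell_A1_eq(4) \<alpha> \<beta>)

lemma chord_F_generic:
  assumes k2: "2 * (k + 1) < n"
    and hi: "\<And>\<psi>. 0 < \<psi> \<Longrightarrow> \<psi> < \<beta> \<Longrightarrow>
      s * sin (\<kappa> + 2 * \<beta> - \<psi>) < 2 * r * sin (\<kappa> + \<beta>) * sin (\<kappa> + 2 * \<beta>)"
  shows "chord_F n r s = 1 - hk n r k s (A1 n r k) (B1 n k)
           + hk n r (k + 1) s (A1 n r k) (B1 n k + pi / real n)"
proof -
  let ?c = "\<alpha> - \<kappa>"
  let ?g = "\<lambda>\<psi>. if \<psi> < ?c then upper_end n r s k \<psi> else upper_end n r s (k + 1) (\<beta> - \<psi>)"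
  have c: "0 \<le> ?c" "?c \<le> \<beta>" using alpha_bounds by auto
  have "(?g has_integral (upper_end_prim n r s k ?c - upper_end_prim n r s k 0) +
      (upper_end_prim n r s (k + 1) (\<beta> - ?c) - upper_end_prim n r s (k + 1) (\<beta> - \<beta>))) {0..\<beta>}"
    by (intro has_integral_if_less c upper_end_has_integral upper_end_reflect_has_integral)
  then have "chord_F n r s = 1 - ((upper_end_prim n r s k ?c - upper_end_prim n r s k 0) +
      (upper_end_prim n r s (k + 1) (\<beta> - ?c) - upper_end_prim n r s (k + 1) (\<beta> - \<beta>))) / (r * sin (pi / n))"
    unfolding \<beta>
  proof (rule chord_F_eq[OF n r less_imp_le[OF s(3)] _ finite.emptyI, where j = "Suc k"], fold \<beta>)
    fix \<psi> assume \<psi>: "0 < \<psi>" "\<psi> < \<beta>"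
    show "?g \<psi> = (if long_chords n r s (real (Suc k) * \<beta> + \<psi>) = {} then 0
        else Sup (long_chords n r s (real (Suc k) * \<beta> + \<psi>)))"
      using Sup_long_chords_first[OF \<psi>] Sup_long_chords_second[OF \<psi> _ k2 hi[OF \<psi>]]
      by (cases "\<psi> < ?c") simp_all
  qed
  \<comment> \<open>The mirrored change of offset is \<open>b - arcsin (a / s)\<close> for
    \<open>b = B1 n k + pi / n\<close>.\<close>
  moreover have "\<beta> - ?c = \<kappa> + \<beta> - \<alpha>" by simp
  ultimately show ?thesis
    unfolding hk_first hk_second by (simp add: upper_end_prim_0 \<beta>[symmetric] add_divide_distrib)
qed

text \<open>Offset \<open>k + 1\<close> belongs to parallel sides. As sine is symmetric about \<pi>
  / 2, the condition that leaves no long chord there coincides with the one that ends offset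
  \<open>k\<close>, so the rest of the cell contributes 0.\<close>

lemma chord_F_even_last:
  assumes k2: "2 * (k + 1) = n"
  shows "chord_F n r s = 1 - hk n r k s (A1 n r k) (B1 n k)"
proof -
  let ?c = "\<alpha> - \<kappa>"
  let ?g = "\<lambda>\<psi>. if \<psi> < ?c then upper_end n r s k \<psi> else 0"
  have c: "0 \<le> ?c" "?c \<le> \<beta>" using alpha_bounds by auto
  have "real (2 * (k + 1)) * \<beta> = pi" unfolding k2 by (rule cell_angles)
  then have half: "\<kappa> + \<beta> = pi / 2" by (simp add: \<kappa> algebra_simps)
  have "(?g has_integral (upper_end_prim n r s k ?c - upper_end_prim n r s k 0) + 0) {0..\<beta>}"
    by (intro has_integral_if_less c upper_end_has_integral has_integral_0)
  then have "chord_F n r s = 1 - ((upper_end_prim n r s k ?c - upper_end_prim n r s k 0) + 0) / (r * sin (pi / n))"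
    unfolding \<beta>
  proof (rule chord_F_eq[OF n r less_imp_le[OF s(3)] _ finite.emptyI, where j = "Suc k"], fold \<beta>)
    fix \<psi> assume \<psi>: "0 < \<psi>" "\<psi> < \<beta>"
    have "long_chords n r s (real (Suc k) * \<beta> + \<psi>) = {}" if "?c \<le> \<psi>"
    proof (rule long_chords_empty_second[OF \<psi>])
      show "k + 1 = n div 2" using k2 by simp
      have "\<kappa> + 2 * \<beta> - \<psi> = pi - (\<kappa> + \<psi>)" "\<kappa> + 2 * \<beta> = pi - \<kappa>" using half by simp_all
      then have "sin (\<kappa> + 2 * \<beta> - \<psi>) = sin (\<kappa> + \<psi>)" "sin (\<kappa> + 2 * \<beta>) = sin \<kappa>"
        by (simp_all only: sin_pi_minus)
      then show "2 * r * sin (\<kappa> + \<beta>) * sin (\<kappa> + 2 * \<beta>) \<le> s * sin (\<kappa> + 2 * \<beta> - \<psi>)"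
        using A1_le_second[OF \<psi>(2) that] by (simp add: mult_ac)
    qed
    then show "?g \<psi> = (if long_chords n r s (real (Suc k) * \<beta> + \<psi>) = {} then 0
        else Sup (long_chords n r s (real (Suc k) * \<beta> + \<psi>)))"
      using Sup_long_chords_first[OF \<psi>] by (cases "\<psi> < ?c") simp_all
  qed
  then show ?thesis unfolding hk_first by (simp add: upper_end_prim_0 \<beta>[symmetric])
qed

text \<open>Offset \<open>k + 1\<close> ends where the vertex chord
  \<open>A2 n r / sin (\<kappa> + 2 * \<beta> - \<psi>)\<close> is at most \<open>s\<close>. This
  happens on an interval symmetric about the middle of the cell, from \<open>u2\<close> to
  \<open>u3 = \<beta> - u2\<close>. The two extra terms are the primitive at the mirrored ends of
  this gap.\<close>

lemma chord_F_odd_last: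
  assumes k2: "2 * (k + 1) + 1 = n" and lam: "lam n r \<le> s"
  shows "chord_F n r s = 1 - hk n r k s (A1 n r k) (B1 n k)
           + hk n r (k + 1) s (A1 n r k) (B1 n k + pi / real n)
           - hk n r (k + 1) s (A2 n r) (B2 n + pi / real n)
           - hk n r (k + 1) s (A2 n r) (B2 n)"
proof -
  define \<alpha>2 where "\<alpha>2 = arcsin (A2 n r / s)"
  define u1 where "u1 = \<alpha> - \<kappa>"
  define u2 where "u2 = \<alpha>2 - (\<kappa> + \<beta>)"
  define u3 where "u3 = \<kappa> + 2 * \<beta> - \<alpha>2"
  have "real (2 * (k + 1) + 1) * \<beta> = pi" unfolding k2 by (rule cell_angles)
  then have sum: "2 * \<kappa> + 3 * \<beta> = pi" by (simp add: \<kappa> algebra_simps)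
  have B2: "B2 n = \<kappa> + \<beta>"
  proof -
    have "B2 n = pi / 2 - \<beta> / 2" by (simp add: B2_def \<beta> algebra_simps)
    then show ?thesis using sum by simp
  qed
  have sins: "sin (\<kappa> + \<beta>) = cos (pi / (2 * n))" "sin (\<kappa> + 2 * \<beta>) = cos (pi / (2 * n))"
  proof -
    have "pi / (2 * n) = \<beta> / 2" by (simp add: \<beta>)
    then have "\<kappa> + \<beta> = pi / 2 - pi / (2 * n)" "\<kappa> + 2 * \<beta> = pi / 2 + pi / (2 * n)" using sum by simp_all
    then show "sin (\<kappa> + \<beta>) = cos (pi / (2 * n))" "sin (\<kappa> + 2 * \<beta>) = cos (pi / (2 * n))"
      by (simp_all only: sin_diff sin_add) simp_all
  qed
  then have sin_eq: "sin (\<kappa> + \<beta>) = sin (\<kappa> + 2 * \<beta>)" by simp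
  have pos: "0 < sin (\<kappa> + \<beta>)" using cell_angles pi_gt_zero by (intro sin_gt_zero) auto
  have A2: "A2 n r = 2 * r * sin (\<kappa> + \<beta>) * sin (\<kappa> + 2 * \<beta>)"
    unfolding A2_def sins by (simp add: power2_eq_square)
  have A2_bounds: "0 \<le> A2 n r" "A2 n r \<le> s" using lam r by (simp_all add: A2_def lam_def)
  then have A: "0 \<le> A2 n r / s" "A2 n r / s \<le> 1" using s by auto
  have sin_\<alpha>2: "s * sin \<alpha>2 = A2 n r" using A s by (simp add: \<alpha>2_def)
  have \<alpha>2_half: "\<alpha>2 \<le> pi / 2" unfolding \<alpha>2_def using A by (intro arcsin_ubound) auto
  have "sin (\<kappa> + \<beta>) \<le> A2 n r / s"
  proof -
    have "s * sin (\<kappa> + \<beta>) \<le> 2 * r * sin (\<kappa> + \<beta>) * sin (\<kappa> + \<beta>)"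
      using s(2)[unfolded ell_A1_eq(2)] pos by (intro mult_right_mono) auto
    then show ?thesis using s(3) sin_eq by (simp add: A2 field_simps)
  qed
  then have \<alpha>2_ge: "\<kappa> + \<beta> \<le> \<alpha>2"
    unfolding \<alpha>2_def using cell_angles A by (subst le_arcsin_iff) auto
  have u2: "0 \<le> u2" "u2 \<le> \<beta>" "u2 \<le> u3" "u3 \<le> \<beta>"
    using \<alpha>2_ge \<alpha>2_half sum cell_angles by (auto simp: u2_def u3_def)
  have u1: "0 \<le> u1" using alpha_bounds by (simp add: u1_def)
  \<comment> \<open>The change of offset precedes the gap: at \<open>u2\<close> the vertex chord of
    offset \<open>k + 1\<close> equals \<open>s\<close>, and by \<open>vertex_chord_mono\<close>
    that of offset \<open>k\<close> is no longer.\<close>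
  have u12: "u1 \<le> u2"
  proof -
    have "sin \<kappa> * sin (\<kappa> + 2 * \<beta> - u2) \<le> sin (\<kappa> + 2 * \<beta>) * sin (\<kappa> + u2)"
      using u2 cell_angles sum by (intro vertex_chord_mono sin_ge_zero) auto
    moreover have "\<kappa> + 2 * \<beta> - u2 = pi - \<alpha>2" using sum by (simp add: u2_def)
    then have "sin (\<kappa> + 2 * \<beta> - u2) = sin \<alpha>2" by (simp only: sin_pi_minus)
    ultimately have "sin \<kappa> * (s * sin \<alpha>2) \<le> sin (\<kappa> + 2 * \<beta>) * (s * sin (\<kappa> + u2))"
      using s(3) by (simp add: mult.left_commute)
    then have "sin (\<kappa> + 2 * \<beta>) * A1 n r k \<le> sin (\<kappa> + 2 * \<beta>) * (s * sin (\<kappa> + u2))"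
      unfolding sin_\<alpha>2 A2 ell_A1_eq by (simp add: mult_ac)
    then have "A1 n r k \<le> s * sin (\<kappa> + u2)" using pos sin_eq by simp
    then have "A1 n r k / s \<le> sin (\<kappa> + u2)" using s(3) by (simp add: field_simps)
    moreover have "0 \<le> A1 n r k / s" "A1 n r k / s \<le> 1" using A1_bounds s(3) by auto
    then have "- 1 \<le> A1 n r k / s" "A1 n r k / s \<le> 1" by linarith+
    ultimately have "\<alpha> \<le> \<kappa> + u2"
      unfolding \<alpha> using cell_angles(1-3) u2 by (subst arcsin_le_iff) auto
    then show ?thesis by (simp add: u1_def)
  qed
  let ?P = "upper_end_prim n r s" and ?E = "upper_end n r s"
  let ?g = "\<lambda>\<psi>. if \<psi> < u1 then ?E k \<psi> else if \<psi> < u2 then ?E (k + 1) (\<beta> - \<psi>)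
      else if \<psi> < u3 then 0 else ?E (k + 1) (\<beta> - \<psi>)"
  let ?I = "(?P k u1 - ?P k 0) + ((?P (k + 1) (\<beta> - u1) - ?P (k + 1) (\<beta> - u2)) +
      (0 + (?P (k + 1) (\<beta> - u3) - ?P (k + 1) (\<beta> - \<beta>))))"
  have "(?g has_integral ?I) {0..\<beta>}"
    using u1 u2 u12 by (intro has_integral_if_less upper_end_has_integral upper_end_reflect_has_integral has_integral_0) auto
  then have "chord_F n r s = 1 - ?I / (r * sin (pi / n))"
    unfolding \<beta>
  \<comment> \<open>At \<open>u3\<close> the vertex chord is exactly \<open>s\<close>, so the slice
    is empty while \<open>?g\<close> already has its value for offset \<open>k + 1\<close>; this one
    direction is excepted.\<close>
  proof (rule chord_F_eq[OF n r less_imp_le[OF s(3)], where j = "Suc k" and N = "{u3}"], fold \<beta>)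
    fix \<psi> assume \<psi>: "0 < \<psi>" "\<psi> < \<beta>" "\<psi> \<notin> {u3}"
    have k2': "2 * (k + 1) < n" "k + 1 = n div 2" using k2 by auto
    note second = Sup_long_chords_second[OF \<psi>(1,2) _ k2'(1)] long_chords_empty_second[OF \<psi>(1,2) k2'(2)]
    have low: "s * sin (\<kappa> + 2 * \<beta> - \<psi>) < 2 * r * sin (\<kappa> + \<beta>) * sin (\<kappa> + 2 * \<beta>)"
      if "\<psi> < u2 \<or> u3 < \<psi>"
    proof -
      have "sin (\<kappa> + 2 * \<beta> - \<psi>) < sin \<alpha>2"
        using that
      proof
        assume "\<psi> < u2"
        have "\<kappa> + 2 * \<beta> - \<psi> = pi - (\<kappa> + \<beta> + \<psi>)" using sum by simp
        then have "sin (\<kappa> + 2 * \<beta> - \<psi>) = sin (\<kappa> + \<beta> + \<psi>)" by (simp only: sin_pi_minus)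
        also have "\<dots> < sin \<alpha>2"
          using \<open>\<psi> < u2\<close> \<psi> cell_angles \<alpha>2_half pi_gt_zero by (intro sin_monotone_2pi) (auto simp: u2_def)
        finally show ?thesis .
      next
        assume "u3 < \<psi>"
        then show ?thesis
          using \<psi> cell_angles \<alpha>2_half pi_gt_zero by (intro sin_monotone_2pi) (auto simp: u3_def)
      qed
      then have "s * sin (\<kappa> + 2 * \<beta> - \<psi>) < s * sin \<alpha>2" using s(3) by simp
      then show ?thesis unfolding sin_\<alpha>2 A2 .
    qed
    have high: "2 * r * sin (\<kappa> + \<beta>) * sin (\<kappa> + 2 * \<beta>) \<le> s * sin (\<kappa> + 2 * \<beta> - \<psi>)"
      if "u2 \<le> \<psi>" "\<psi> < u3"
    proof -
      have "sin \<alpha>2 \<le> sin (\<kappa> + 2 * \<beta> - \<psi>)"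
      proof (cases "\<kappa> + 2 * \<beta> - \<psi> \<le> pi / 2")
        case True
        then show ?thesis
          using that cell_angles \<alpha>2_ge pi_gt_zero by (intro sin_monotone_2pi_le) (auto simp: u3_def)
      next
        case False
        have "\<kappa> + 2 * \<beta> - \<psi> = pi - (\<kappa> + \<beta> + \<psi>)" using sum by simp
        then have "sin (\<kappa> + 2 * \<beta> - \<psi>) = sin (\<kappa> + \<beta> + \<psi>)" by (simp only: sin_pi_minus)
        moreover have "sin \<alpha>2 \<le> sin (\<kappa> + \<beta> + \<psi>)"
          using that False sum cell_angles \<alpha>2_ge pi_gt_zero by (intro sin_monotone_2pi_le) (auto simp: u2_def)
        ultimately show ?thesis by simp
      qed
      then have "s * sin \<alpha>2 \<le> s * sin (\<kappa> + 2 * \<beta> - \<psi>)" using s(3) by simp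
      then show ?thesis unfolding sin_\<alpha>2 A2 .
    qed
    consider "\<psi> < u1" | "u1 \<le> \<psi>" "\<psi> < u2" | "u2 \<le> \<psi>" "\<psi> < u3" | "u3 < \<psi>" using \<psi>(3) by fastforce
    then show "?g \<psi> = (if long_chords n r s (real (Suc k) * \<beta> + \<psi>) = {} then 0
        else Sup (long_chords n r s (real (Suc k) * \<beta> + \<psi>)))"
    proof cases
      case 1
      then show ?thesis using Sup_long_chords_first[OF \<psi>(1,2)] by (simp add: u1_def)
    next
      case 2
      then show ?thesis using second(1,2) low by (simp add: u1_def)
    next
      case 3
      then show ?thesis using second(3) high u12 by simp
    next
      case 4
      then show ?thesis using second(1,2) low u12 u2 by (simp add: u1_def)
    qed
  qed simp
  moreover have "hk n r (k + 1) s (A2 n r) (B2 n + pi / n) = - ?P (k + 1) u3 / (r * sin \<beta>)"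
  proof -
    have "B2 n + pi / n - \<alpha>2 = u3" by (simp add: B2 \<beta>[symmetric] u3_def)
    then show ?thesis
      using hk_eq_upper_end_prim[OF _ _ s(3) A2_bounds, of "k + 1" r n "B2 n + pi / n"] r
      by (simp add: \<alpha>2_def \<beta>)
  qed
  moreover have "hk n r (k + 1) s (A2 n r) (B2 n) = ?P (k + 1) u2 / (r * sin \<beta>)"
  proof -
    have "B2 n - \<alpha>2 = - u2" by (simp add: B2 u2_def)
    then show ?thesis
      using hk_eq_upper_end_prim[OF _ _ s(3) A2_bounds, of "k + 1" r n "B2 n"] r
      by (simp add: \<alpha>2_def \<beta> upper_end_prim_minus)
  qed
  moreover have "\<beta> - u1 = \<kappa> + \<beta> - \<alpha>" "\<beta> - u2 = u3" "\<beta> - u3 = u2"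
    using sum by (simp_all add: u1_def u2_def u3_def)
  ultimately show ?thesis
    unfolding hk_first hk_second
    by (simp add: upper_end_prim_0 \<beta>[symmetric] u1_def[symmetric] add_divide_distrib diff_divide_distrib)
qed

end

section \<open>Lengths at which the distribution function is 0 or 1\<close>

lemma chord_F_neg:
  assumes "s < 0"
  shows "chord_F n r s = 0"
proof -
  have "bounded (line_pphi p \<phi> \<inter> reg_polygon n r)" for p \<phi>
    using compact_imp_bounded[OF compact_reg_polygon] by blast
  then have "\<not> diameter (line_pphi p \<phi> \<inter> reg_polygon n r) \<le> s" for p \<phi>
    using diameter_ge_0 assms by (metis linorder_not_less order_less_le_trans)
  then show ?thesis by (simp add: chord_F_def)
qed

text \<open>For \<open>s = 0\<close> offset 1 serves a whole cell, and \<open>upper_end\<close>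
  reduces to the support function \<open>r * cos \<psi>\<close>: chords of positive length already
  have the full measure.\<close>

lemma chord_F_0:
  assumes n: "3 \<le> n" and r: "0 < r"
  shows "chord_F n r 0 = 0"
proof -
  let ?\<beta> = "pi / real n"
  have k: "1 \<le> (1::nat)" "2 * 1 \<le> n" "2 * 1 < n" using n by auto
  have \<kappa>: "?\<beta> = real 1 * ?\<beta>" by simp
  have npos: "0 < real n" using n by simp
  have pos: "0 < sin ?\<beta>" "0 < sin (?\<beta> + ?\<beta>)" "0 < cos ?\<beta>"
  proof -
    have "real 3 \<le> real n" using n by (simp only: of_nat_le_iff)
    then have "?\<beta> \<le> pi / 3" by (intro divide_left_mono) auto
    moreover have "0 < ?\<beta>" using npos by simp
    ultimately have "0 < ?\<beta>" "?\<beta> < pi" "?\<beta> + ?\<beta> < pi" "?\<beta> < pi / 2" "0 < ?\<beta> + ?\<beta>"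
      using pi_gt_zero by linarith+
    then show "0 < sin ?\<beta>" "0 < sin (?\<beta> + ?\<beta>)" "0 < cos ?\<beta>"
      using sin_gt_zero cos_gt_zero by blast+
  qed
  have "chord_F n r 0 = 1 - (upper_end_prim n r 0 1 ?\<beta> - upper_end_prim n r 0 1 0) / (r * sin ?\<beta>)"
  proof (rule chord_F_eq[OF n r order_refl upper_end_has_integral finite.emptyI, where j = "Suc 1"])
    show "0 \<le> ?\<beta>" by simp
    fix \<psi> assume \<psi>: "0 < \<psi>" "\<psi> < ?\<beta>"
    note Sup_long_chords[OF n r k(1,2) refl \<kappa> refl \<psi> k(3), of 0]
    then show "upper_end n r 0 1 \<psi> = (if long_chords n r 0 (real (Suc 1) * ?\<beta> + \<psi>) = {} then 0
        else Sup (long_chords n r 0 (real (Suc 1) * ?\<beta> + \<psi>)))"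
      using pos r by simp
  qed
  also have "\<dots> = 0" using pos r by (simp add: upper_end_prim_def)
  finally show ?thesis .
qed

lemma sin_ge_sin_of_sum_ge_pi:
  fixes x y :: real
  assumes "x \<le> y" "pi \<le> x + y" "y \<le> pi" "0 \<le> x"
  shows "sin y \<le> sin x"
proof -
  have "sin y - sin x = 2 * sin ((y - x) / 2) * cos ((y + x) / 2)" by (rule sin_diff_sin)
  moreover have "0 \<le> sin ((y - x) / 2)" using assms by (intro sin_ge_zero) auto
  moreover have "cos ((y + x) / 2) \<le> 0" using assms cos_monotone_0_pi_le[of "pi / 2" "(y + x) / 2"] by simp
  ultimately have "sin y - sin x \<le> 0" by (simp add: mult_nonneg_nonpos)
  then show ?thesis by simp
qed

text \<open>At the largest offset \<open>\<kappa> + \<beta>\<close> is at least as far from \<pi> /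
  2 as \<open>\<kappa> + \<psi>\<close>, so the vertex chord is at most
  \<open>2 * r * sin \<kappa>\<close>, the longest diagonal.\<close>

lemma chord_F_eq_1:
  assumes n: "3 \<le> n" and r: "0 < r" and s: "ell n r (n div 2) \<le> s"
  shows "chord_F n r s = 1"
proof -
  define k where "k = n div 2"
  define \<beta> where "\<beta> = pi / n"
  define \<kappa> where "\<kappa> = real k * \<beta>"
  have k: "1 \<le> k" "2 * k \<le> n" "n \<le> 2 * k + 1" using n by (auto simp: k_def)
  have nb: "real n * \<beta> = pi" and b: "0 < \<beta>" using n by (simp_all add: \<beta>_def)
  have "real (2 * k) * \<beta> \<le> real n * \<beta>" "real n * \<beta> \<le> real (2 * k + 1) * \<beta>" "real 3 * \<beta> \<le> real n * \<beta>"
    using k n b by (intro mult_right_mono; simp only: of_nat_le_iff; simp)+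
  then have \<kappa>: "2 * \<kappa> \<le> pi" "pi \<le> 2 * \<kappa> + \<beta>" "3 * \<beta> \<le> pi"
    unfolding nb by (simp_all add: \<kappa>_def algebra_simps)
  have \<kappa>0: "0 < \<kappa>" using k b by (simp add: \<kappa>_def)
  have sk: "2 * r * sin \<kappa> \<le> s" using s by (simp add: ell_def \<kappa>_def k_def \<beta>_def)
  have sp: "0 \<le> sin \<kappa>" "0 \<le> sin (\<kappa> + \<beta>)" using \<kappa> \<kappa>0 b by (auto intro!: sin_ge_zero)
  then have s0: "0 \<le> s" using sk r by (meson mult_nonneg_nonneg order_trans less_imp_le zero_le_numeral)
  have "chord_F n r s = 1 - 0 / (r * sin (pi / n))"
  proof (rule chord_F_eq[OF n r s0 has_integral_0 finite.emptyI, where j = "Suc k"], fold \<beta>_def)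
    fix \<psi> assume \<psi>: "0 < \<psi>" "\<psi> < \<beta>"
    have "sin (\<kappa> + \<beta>) \<le> sin (\<kappa> + \<psi>)"
      using \<psi> \<kappa> \<kappa>0 b by (intro sin_ge_sin_of_sum_ge_pi) auto
    then have "2 * r * sin \<kappa> * sin (\<kappa> + \<beta>) \<le> s * sin (\<kappa> + \<psi>)"
      using sk s0 sp by (intro mult_mono)
    then show "0 = (if long_chords n r s (real (Suc k) * \<beta> + \<psi>) = {} then 0
        else Sup (long_chords n r s (real (Suc k) * \<beta> + \<psi>)))"
      using long_chords_empty[OF n r k_def \<beta>_def \<kappa>_def \<psi>] by simp
  qed
  then show ?thesis by simp
qed

text \<open>This forces \<open>k = Kn n\<close> once \<open>lam n r \<le> s\<close>. With
  \<open>x = pi / (2 * n)\<close> it reduces to \<open>cos (3 * x) \<le> (cos x)\<^sup>2\<close>,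
  which after splitting off \<open>cos x\<close> is the factorization
  \<open>(4 * cos x + 3) * (1 - cos x) \<ge> 0\<close>.\<close>

lemma ell_le_lam:
  assumes r: "0 < r" and k: "2 * k + 3 \<le> n"
  shows "ell n r k \<le> lam n r"
proof -
  let ?x = "pi / (2 * n)"
  have npos: "0 < real n" and n3: "3 \<le> n" using k by simp_all
  have "0 \<le> ?x" "?x \<le> pi / 2" using npos n3 by (simp_all add: field_simps)
  then have c: "0 \<le> cos ?x" by (intro cos_ge_zero) linarith+
  have "real (2 * k + 3) \<le> real n" using k by (simp only: of_nat_le_iff)
  then have "(2 * real k + 3) * pi \<le> real n * pi" by (intro mult_right_mono) auto
  then have le: "real k * pi / n \<le> pi / 2 - 3 * ?x" using npos by (simp add: field_simps)
  have "sin (real k * pi / n) \<le> sin (pi / 2 - 3 * ?x)"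
  proof (rule sin_monotone_2pi_le[OF _ le])
    have "0 \<le> real k * pi / n" by simp
    then show "- (pi / 2) \<le> real k * pi / n" using pi_gt_zero by linarith
    have "0 \<le> 3 * ?x" by simp
    then show "pi / 2 - 3 * ?x \<le> pi / 2" by linarith
  qed
  also have "\<dots> = cos (3 * ?x)" by (simp add: cos_sin_eq)
  also have "\<dots> = cos ?x * (4 * (cos ?x)\<^sup>2 - 3)"
    by (simp only: cos_treble_cos) (simp add: power3_eq_cube power2_eq_square algebra_simps)
  also have "\<dots> \<le> cos ?x * cos ?x"
  proof (rule mult_left_mono[OF _ c])
    have "0 \<le> (4 * cos ?x + 3) * (1 - cos ?x)" using c by (intro mult_nonneg_nonneg) auto
    then show "4 * (cos ?x)\<^sup>2 - 3 \<le> cos ?x" by (simp add: algebra_simps power2_eq_square)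
  qed
  finally have "2 * r * sin (real k * pi / n) \<le> 2 * r * (cos ?x * cos ?x)"
    using r by (intro mult_left_mono) auto
  then show ?thesis by (simp add: ell_def lam_def power2_eq_square)
qed

text \<open>Case (i) of the formula: the chord through the vertex that ends offset \<open>k + 1\<close> is longer than
  \<open>s\<close> in every direction.\<close>
lemma chord_F_inner:
  assumes n: "3 \<le> n" and r: "0 < r" and k2: "2 * (k + 1) < n"
    and s: "ell n r k \<le> s" "s < ell n r (k + 1)" "0 < s"
    and lam: "2 * (k + 1) + 1 = n \<Longrightarrow> s < lam n r"
  shows "chord_F n r s = 1 - hk n r k s (A1 n r k) (B1 n k)
           + hk n r (k + 1) s (A1 n r k) (B1 n k + pi / real n)"
proof -
  define \<beta> where "\<beta> = pi / n"
  define \<kappa> where "\<kappa> = real k * \<beta>"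
  have k: "k + 1 \<le> n div 2" using k2 by simp
  note cell = n r \<beta>_def \<kappa>_def k s refl
  have nb: "real n * \<beta> = pi" and b: "0 < \<beta>" using n by (simp_all add: \<beta>_def)
  have \<kappa>0: "0 \<le> \<kappa>" using b by (simp add: \<kappa>_def)
  have ell: "ell n r (k + 1) = 2 * r * sin (\<kappa> + \<beta>)" by (rule ell_A1_eq(2)[OF cell])
  have "s * sin (\<kappa> + 2 * \<beta> - \<psi>) < 2 * r * sin (\<kappa> + \<beta>) * sin (\<kappa> + 2 * \<beta>)"
    if \<psi>: "0 < \<psi>" "\<psi> < \<beta>" for \<psi>
  proof (cases "2 * (k + 1) + 1 = n")
    case True
    have "real (2 * (k + 1) + 1) * \<beta> = pi" unfolding True by (rule nb)
    then have sum: "2 * \<kappa> + 3 * \<beta> = pi" by (simp add: \<kappa>_def algebra_simps)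
    have "pi / (2 * n) = \<beta> / 2" by (simp add: \<beta>_def)
    then have "\<kappa> + \<beta> = pi / 2 - pi / (2 * n)" "\<kappa> + 2 * \<beta> = pi / 2 + pi / (2 * n)" using sum by simp_all
    then have "sin (\<kappa> + \<beta>) = cos (pi / (2 * n))" "sin (\<kappa> + 2 * \<beta>) = cos (pi / (2 * n))"
      by (simp_all only: sin_diff sin_add) simp_all
    then have "2 * r * sin (\<kappa> + \<beta>) * sin (\<kappa> + 2 * \<beta>) = lam n r"
      by (simp add: lam_def power2_eq_square)
    moreover have "s * sin (\<kappa> + 2 * \<beta> - \<psi>) \<le> s * 1" using s(3) by (intro mult_left_mono) auto
    ultimately show ?thesis using lam[OF True] by linarith
  next
    case False
    then have "2 * (k + 2) \<le> n" using k2 by simp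
    then have "real (2 * (k + 2)) \<le> real n" by (simp only: of_nat_le_iff)
    then have "real (2 * (k + 2)) * \<beta> \<le> real n * \<beta>" using b by (intro mult_right_mono) auto
    \<comment> \<open>A further offset exists, so the angles stay below \<pi> / 2, where
      monotonicity of sine and \<open>s < ell n r (k + 1)\<close> suffice.\<close>
    then have half: "\<kappa> + 2 * \<beta> \<le> pi / 2" unfolding nb by (simp add: \<kappa>_def algebra_simps)
    have "0 < sin (\<kappa> + 2 * \<beta> - \<psi>)"
      using half \<psi> \<kappa>0 b pi_gt_zero by (intro sin_gt_zero) auto
    then have "s * sin (\<kappa> + 2 * \<beta> - \<psi>) < 2 * r * sin (\<kappa> + \<beta>) * sin (\<kappa> + 2 * \<beta> - \<psi>)"
      using s(2) unfolding ell by simp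
    also have "\<dots> \<le> 2 * r * sin (\<kappa> + \<beta>) * sin (\<kappa> + 2 * \<beta>)"
    proof (rule mult_left_mono)
      show "sin (\<kappa> + 2 * \<beta> - \<psi>) \<le> sin (\<kappa> + 2 * \<beta>)"
        using half \<psi> \<kappa>0 b pi_gt_zero by (intro sin_monotone_2pi_le) auto
      show "0 \<le> 2 * r * sin (\<kappa> + \<beta>)" using s unfolding ell by simp
    qed
    finally show ?thesis .
  qed
  then show ?thesis by (rule chord_F_generic[OF cell k2])
qed

theorem theorem1:
  fixes n :: nat and r :: real
  assumes "n \<ge> 3" and "r > 0"
  shows "(\<forall>s::real. s \<le> 0 \<longrightarrow> chord_F n r s = 0)
       \<and> (\<forall>s::real. s \<ge> ell n r (Kn n + 1) \<longrightarrow> chord_F n r s = 1)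
       \<and> (\<forall>k s. k \<le> Kn n \<longrightarrow> ell n r k \<le> s \<longrightarrow> s < ell n r (k + 1) \<longrightarrow> s > 0 \<longrightarrow>
            (((even n \<and> k < Kn n) \<or> (odd n \<and> s < lam n r)) \<longrightarrow>
               chord_F n r s = 1 - hk n r k s (A1 n r k) (B1 n k)
                                 + hk n r (k + 1) s (A1 n r k) (B1 n k + pi / real n))
          \<and> ((odd n \<and> s \<ge> lam n r) \<longrightarrow>
               chord_F n r s = 1 - hk n r (Kn n) s (A1 n r (Kn n)) (B1 n (Kn n))
                                 + hk n r (Kn n + 1) s (A1 n r (Kn n)) (B1 n (Kn n) + pi / real n)
                                 - hk n r (Kn n + 1) s (A2 n r) (B2 n + pi / real n)
                                 - hk n r (Kn n + 1) s (A2 n r) (B2 n))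
          \<and> ((even n \<and> k = Kn n) \<longrightarrow>
               chord_F n r s = 1 - hk n r (Kn n) s (A1 n r (Kn n)) (B1 n (Kn n))))"
proof (intro conjI allI impI)
  have K: "Kn n + 1 = n div 2" using assms(1) by (simp add: Kn_def)
  show "chord_F n r s = 0" if "s \<le> 0" for s
    using that chord_F_neg chord_F_0[OF assms] by (cases "s = 0") auto
  show "chord_F n r s = 1" if "ell n r (Kn n + 1) \<le> s" for s
    using that chord_F_eq_1[OF assms] by (simp only: K)
  fix k s
  assume k: "k \<le> Kn n" and s: "ell n r k \<le> s" "s < ell n r (k + 1)" "0 < s"
  have k': "k + 1 \<le> n div 2" using k K by simp
  show "chord_F n r s = 1 - hk n r k s (A1 n r k) (B1 n k)
      + hk n r (k + 1) s (A1 n r k) (B1 n k + pi / real n)"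
    if c: "(even n \<and> k < Kn n) \<or> (odd n \<and> s < lam n r)"
  proof (rule chord_F_inner[OF assms _ s])
    show "2 * (k + 1) < n"
    proof (cases "even n")
      case True
      then show ?thesis using c K by auto
    next
      case False
      then obtain m where "n = 2 * m + 1" by (elim oddE)
      then show ?thesis using k' by simp
    qed
    show "s < lam n r" if "2 * (k + 1) + 1 = n" using c that by auto
  qed
  show "chord_F n r s = 1 - hk n r (Kn n) s (A1 n r (Kn n)) (B1 n (Kn n))
      + hk n r (Kn n + 1) s (A1 n r (Kn n)) (B1 n (Kn n) + pi / real n)
      - hk n r (Kn n + 1) s (A2 n r) (B2 n + pi / real n)
      - hk n r (Kn n + 1) s (A2 n r) (B2 n)"
    if c: "odd n \<and> lam n r \<le> s"
  proof -
    have nK: "2 * (Kn n + 1) + 1 = n" using c K by (simp add: odd_two_times_div_two_succ)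
    \<comment> \<open>For smaller \<open>k\<close> even \<open>ell n r (k + 1)\<close> would be at
      most \<open>lam n r\<close>, leaving no room for \<open>s\<close>.\<close>
    have "k = Kn n"
    proof (rule ccontr)
      assume "k \<noteq> Kn n"
      then have "k < Kn n" using k by simp
      then have "2 * (k + 1) + 3 \<le> n" using nK by arith
      then show False using ell_le_lam[OF assms(2)] s(2) c by fastforce
    qed
    then show ?thesis
      using chord_F_odd_last[OF assms refl refl k' s refl _ conjunct2[OF c]] nK by simp
  qed
  show "chord_F n r s = 1 - hk n r (Kn n) s (A1 n r (Kn n)) (B1 n (Kn n))"
    if c: "even n \<and> k = Kn n"
  proof -
    have "2 * (k + 1) = n" using c K by auto
    then show ?thesis using chord_F_even_last[OF assms refl refl k' s refl] c by simp
  qed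
qed

end
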